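(* Let $N\in\mathbb{N}$, $R_x\ge 0$, let $\mathcal F(\mathbb R^d)$ be a class of closed, convex and proper functions, and suppose that $\{(A^{\mathrm{ic}}_k,a^{\mathrm{ic}}_k,b^{\mathrm{ic}}_k)\}_{k\in K_N}$ encodes the interpolation conditions for $\mathcal F(\mathbb R^d)$. Then for any $(\mathcal F(\mathbb R^d),R_x)$-input $(f,x_0)$, $$f(\mathrm{GFOM}_N(f,x_0))-f_*\ \le\ \mathrm{val}(\mathrm{D}),$$ where (D) is the problem $$\begin{aligned}\inf_{\{\alpha_k\},\{\beta_{i,j}\},\{\gamma_{i,j}\},\tau_x}\ &\ \tau_xR_x^2-\sum_{k\in K_N}\alpha_k b^{\mathrm{ic}}_k\\ \text{subject to: }&\ \alpha_k\ge 0\ (k\in K_N),\quad \tau_x\ge 0,\\ &\ \sum_{k\in K_N}\alpha_kA^{\mathrm{ic}}_k+\sum_{i=1}^N \mathbf g_i\odot\Big[\sum_{j=0}^{i-1}\beta_{i,j}\mathbf g_j+\sum_{j=1}^{i}\gamma_{i,j}(\mathbf x_j-\mathbf x_0)\Big]+\tau_x\,(\mathbf x_0-\mathbf x_* )\odot(\mathbf x_0-\mathbf x_* )\succeq 0,\\ &\ \mathbf f_N-\mathbf f_*-\sum_{k\in K_N}\alpha_ka^{\mathrm{ic}}_k=0,\end{aligned}$$ with real variables $\alpha_k$ ($k\in K_N$), $\beta_{i,j}$ ($1\le i\le N$, $0\le j\le i-1$), $\gamma_{i,j}$ ($1\le i\le N$, $1\le j\le i$), $\tau_x$. Furthermore,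 if $\mathcal F(\mathbb R^d)$ is contraction-preserving, $d\ge 2N+2$, and there exists some $(\mathcal F(\mathbb R^d),R_x)$-input $(\hat f,\hat x_0)$ such that $\mathrm{GFOM}_{2N+1}(\hat f,\hat x_0)$ is not optimal for $\hat f$, then the bound is tight.
   Context: $\langle\cdot,\cdot\rangle$ and $\|\cdot\|$ are the Euclidean inner product and norm; $\mathbb N$ denotes the positive integers; $I^*_N:=\{*,0,1,\dots,N\}$ is an index set; $\mathrm{val}(\cdot)$ is the optimal value of an optimization problem; $f_*:=\min f$. $x\odot y:=\tfrac12(xy^\top+yx^\top)$. For a square matrix $M$, $M\succeq0$ means $v^\top Mv\ge0$ for all $v$. Input: $(f,x_0)$ is an $(\mathcal F(\mathbb R^d),R_x)$-input if $f\in\mathcal F(\mathbb R^d)$, $x_0\in\mathbb R^d$, and $\|x_0-x_*\|\le R_x$ for some $x_*\in\operatorname{argmin}f$. GFOM (greedy first-order method): a run on $(f,x_0)$ with $N$ iterations consists of points $x_1,\dots,x_N$ and subgradients $f'(x_i)\in\partial f(x_i)$, $0\le i\le N$, such that for $i=1,\dots,N$: $x_i\in\operatorname{argmin}\{f(x): x\in x_0+\mathrm{span}\{f'(x_0),\dots,f'(x_{i-1})\}\}$ and $\langle f'(x_i),f'(x_j)\rangle=0$ for all $0\le j<i$. Its output is $\mathrm{GFOM}_N(f,x_0):=x_N$. If $f$ does not attain its infimum on one of the subspaces, there is no output. Bounds on $\mathrm{GFOM}_N(f,x_0)$ are claimed for every output; in existence statements, an input together with a run is meant. Interpolability: a set $\{(x_i,g_i,f_i)\}_{i\in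 I}\subset\mathbb R^d\times\mathbb R^d\times\mathbb R$ is $\mathcal F(\mathbb R^d)$-interpolable if there is $f\in\mathcal F(\mathbb R^d)$ with $g_i\in\partial f(x_i)$ and $f_i=f(x_i)$ for all $i\in I$. Contraction-preserving: $\mathcal F(\mathbb R^d)$ is contraction-preserving if for every finite $I$, every $\mathcal F(\mathbb R^d)$-interpolable $\{(x_i,g_i,f_i)\}_{i\in I}$ and every $\{\hat x_i\}_{i\in I}\subset\mathbb R^d$ with $\|\hat x_i-\hat x_j\|\le\|x_i-x_j\|$ and $\langle g_j,\hat x_i-\hat x_j\rangle=\langle g_j,x_i-x_j\rangle$ for all $i,j\in I$, the set $\{(\hat x_i,g_i,f_i)\}_{i\in I}$ is $\mathcal F(\mathbb R^d)$-interpolable. Coordinates: with $e_k$ the canonical unit vectors, $\mathbf x_i,\mathbf g_i\in\mathbb R^{2N+2}$ and $\mathbf f_i\in\mathbb R^{N+2}$ are: $\mathbf x_0=0$, $\mathbf x_i=e_{N+1+i}$ ($1\le i\le N$), $\mathbf x_*=e_{2N+2}$, $\mathbf g_*=0$, $\mathbf g_i=e_{i+1}$ ($0\le i\le N$), $\mathbf f_i=e_{i+1}$ ($0\le i\le N$), $\mathbf f_*=e_{N+2}$. Encoding of interpolation conditions: $K_N$ is a finite index set, $A^{\mathrm{ic}}_k\in\mathbb R^{(2N+2)\times(2N+2)}$, $a^{\mathrm{ic}}_k\in\mathbb R^{N+2}$, $b^{\mathrm{ic}}_k\in\mathbb R$. They encode the interpolation conditions for $\mathcal F(\mathbb R^d)$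 if, for any set $\{(x_i,g_i,f_i)\}_{i\in I^*_N}$ with $g_*=0$, setting $P=[g_0,\dots,g_N,\,x_1-x_0,\dots,x_N-x_0,\,x_*-x_0]\in\mathbb R^{d\times(2N+2)}$, $G=P^\top P$ and $F=[f_0,\dots,f_N,f_*]^\top$, the set is $\mathcal F(\mathbb R^d)$-interpolable if and only if $\mathrm{Tr}(A^{\mathrm{ic}}_kG)+(a^{\mathrm{ic}}_k)^\top F+b^{\mathrm{ic}}_k\le0$ for all $k\in K_N$. "The bound is tight" means: for every $\varepsilon>0$ there is an $(\mathcal F(\mathbb R^d),R_x)$-input $(f,x_0)$ and an output of GFOM on it with $f(\mathrm{GFOM}_N(f,x_0))-f_*\ge\mathrm{val}(\mathrm D)-\varepsilon$.
   Formalization: If val(D) = +∞ (as for all closed convex proper functions with R_x > 0), tightness as defined fails because f(x_N) − f_* is finite; in that case tightness is taken to mean that f(x_N) − f_* is unbounded over inputs and outputs. *)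

theory Defs
  imports "HOL-Analysis.Analysis" "Jordan_Normal_Form.Matrix"
begin

text \<open>
  \<open>HOL-Analysis\<close> and \<open>Jordan_Normal_Form\<close> both use the names \<open>vec\<close> and \<open>mat\<close> and the infix
  symbols for component access and inner product, so these are written in qualified or prefix
  form. Vectors of \<open>\<real>\<^sup>d\<close> have type \<open>real ^ 'd\<close> with \<open>d = CARD('d)\<close>; vectors and matrices whose size
  depends on \<open>N\<close> are those of \<open>Jordan_Normal_Form\<close>, with entries numbered from 0, so
  that the \<open>k\<close>-th canonical unit vector of \<open>\<real>\<^sup>n\<close> is \<open>unit_vec n (k - 1)\<close>.
\<close>


section \<open>Convex functions, inputs and the greedy first-order method\<close>

text \<open>Functions are extended-valued, with the value \<open>\<infinity>\<close> outside the effective domain.\<close>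

definition ereal_epigraph :: "('a \<Rightarrow> ereal) \<Rightarrow> ('a \<times> real) set" where
  "ereal_epigraph f = {(x, t). f x \<le> ereal t}"

definition proper_fun :: "('a \<Rightarrow> ereal) \<Rightarrow> bool" where
  "proper_fun f \<longleftrightarrow> (\<forall>x. f x \<noteq> -\<infinity>) \<and> (\<exists>x. f x \<noteq> \<infinity>)"

definition closed_convex_proper :: "('a::euclidean_space \<Rightarrow> ereal) \<Rightarrow> bool" where
  "closed_convex_proper f \<longleftrightarrow>
     closed (ereal_epigraph f) \<and> convex (ereal_epigraph f) \<and> proper_fun f"

text \<open>For proper \<open>f\<close> this set is empty at points where \<open>f\<close> is infinite.\<close>

definition subdifferential :: "('a::real_inner \<Rightarrow> ereal) \<Rightarrow> 'a \<Rightarrow> 'a set" where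
  "subdifferential f x = {g. \<forall>y. f x + ereal (inner g (y - x)) \<le> f y}"

definition argmin_on :: "('a \<Rightarrow> ereal) \<Rightarrow> 'a set \<Rightarrow> 'a set" where
  "argmin_on f S = {x. is_arg_min f (\<lambda>y. y \<in> S) x}"

definition min_value :: "('a \<Rightarrow> ereal) \<Rightarrow> ereal" where
  "min_value f = (INF y. f y)"

definition is_input ::
    "('a::euclidean_space \<Rightarrow> ereal) set \<Rightarrow> real \<Rightarrow> ('a \<Rightarrow> ereal) \<Rightarrow> 'a \<Rightarrow> bool" where
  "is_input \<F> R f x0 \<longleftrightarrow> f \<in> \<F> \<and> (\<exists>xs \<in> argmin_on f UNIV. norm (x0 - xs) \<le> R)"

definition gfom_run ::
    "nat \<Rightarrow> ('a::euclidean_space \<Rightarrow> ereal) \<Rightarrow> 'a \<Rightarrow> (nat \<Rightarrow> 'a) \<Rightarrow> (nat \<Rightarrow> 'a) \<Rightarrow> bool" where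
  "gfom_run n f x0 x g \<longleftrightarrow>
     x 0 = x0 \<and>
     (\<forall>i\<le>n. g i \<in> subdifferential f (x i)) \<and>
     (\<forall>i\<in>{1..n}. x i \<in> argmin_on f ((\<lambda>v. x0 + v) ` span (g ` {..<i})) \<and>
                  (\<forall>j<i. inner (g i) (g j) = 0))"

text \<open>The method is a relation rather than a function: an input may have several outputs, or none.\<close>

definition gfom_output ::
    "nat \<Rightarrow> ('a::euclidean_space \<Rightarrow> ereal) \<Rightarrow> 'a \<Rightarrow> 'a \<Rightarrow> bool" where
  "gfom_output n f x0 y \<longleftrightarrow> (\<exists>x g. gfom_run n f x0 x g \<and> y = x n)"


section \<open>Interpolation\<close>

definition interpolable ::
    "('a::euclidean_space \<Rightarrow> ereal) set \<Rightarrow> 'i set \<Rightarrow> ('i \<Rightarrow> 'a) \<Rightarrow> ('i \<Rightarrow> 'a) \<Rightarrow> ('i \<Rightarrow> real) \<Rightarrow> bool"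
  where
  "interpolable \<F> I x g fv \<longleftrightarrow>
     (\<exists>f\<in>\<F>. \<forall>i\<in>I. g i \<in> subdifferential f (x i) \<and> f (x i) = ereal (fv i))"

text \<open>Finite subsets of \<open>\<nat>\<close> represent all finite index sets, up to relabelling.\<close>

definition contraction_preserving :: "('a::euclidean_space \<Rightarrow> ereal) set \<Rightarrow> bool" where
  "contraction_preserving \<F> \<longleftrightarrow>
     (\<forall>(I :: nat set) x g fv x'.
        finite I \<longrightarrow> interpolable \<F> I x g fv \<longrightarrow>
        (\<forall>i\<in>I. \<forall>j\<in>I. norm (x' i - x' j) \<le> norm (x i - x j) \<and>
                       inner (g j) (x' i - x' j) = inner (g j) (x i - x j)) \<longrightarrow>
        interpolable \<F> I x' g fv)"

text \<open>The index set \<open>{*, 0, \<dots>, N}\<close>: \<open>None\<close> stands for \<open>*\<close> and \<open>Some i\<close> for \<open>i\<close>.\<close>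

definition star_index :: "nat \<Rightarrow> nat option set" where
  "star_index N = insert None (Some ` {0..N})"


section \<open>Encoding of interpolation conditions\<close>

text \<open>The columns \<open>g\<^sub>0, \<dots>, g\<^sub>N, x\<^sub>1 - x\<^sub>0, \<dots>, x\<^sub>N - x\<^sub>0, x\<^sub>* - x\<^sub>0\<close> of the matrix \<open>P\<close>.\<close>

definition P_col ::
    "nat \<Rightarrow> (nat option \<Rightarrow> 'a::real_inner) \<Rightarrow> (nat option \<Rightarrow> 'a) \<Rightarrow> nat \<Rightarrow> 'a" where
  "P_col N x g p =
     (if p \<le> N then g (Some p)
      else if p \<le> 2 * N then x (Some (p - N)) - x (Some 0)
      else x None - x (Some 0))"

text \<open>\<open>G = P\<^sup>T P\<close>, whose entries are the inner products of the columns of \<open>P\<close>.\<close>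

definition gram_mat ::
    "nat \<Rightarrow> (nat option \<Rightarrow> 'a::real_inner) \<Rightarrow> (nat option \<Rightarrow> 'a) \<Rightarrow> real Matrix.mat" where
  "gram_mat N x g =
     Matrix.mat (2 * N + 2) (2 * N + 2) (\<lambda>(p, q). inner (P_col N x g p) (P_col N x g q))"

definition value_vec :: "nat \<Rightarrow> (nat option \<Rightarrow> real) \<Rightarrow> real Matrix.vec" where
  "value_vec N fv = Matrix.vec (N + 2) (\<lambda>p. if p \<le> N then fv (Some p) else fv None)"

definition mat_trace :: "real Matrix.mat \<Rightarrow> real" where
  "mat_trace M = (\<Sum>p<dim_row M. M $$ (p, p))"

definition encodes_interpolation ::
    "nat \<Rightarrow> ('a::euclidean_space \<Rightarrow> ereal) set \<Rightarrow> 'k set \<Rightarrow>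
     ('k \<Rightarrow> real Matrix.mat) \<Rightarrow> ('k \<Rightarrow> real Matrix.vec) \<Rightarrow> ('k \<Rightarrow> real) \<Rightarrow> bool" where
  "encodes_interpolation N \<F> K A a b \<longleftrightarrow>
     finite K \<and>
     (\<forall>k\<in>K. A k \<in> carrier_mat (2 * N + 2) (2 * N + 2) \<and> a k \<in> carrier_vec (N + 2)) \<and>
     (\<forall>x g fv. g None = 0 \<longrightarrow>
        (interpolable \<F> (star_index N) x g fv \<longleftrightarrow>
         (\<forall>k\<in>K. mat_trace (A k * gram_mat N x g) + scalar_prod (a k) (value_vec N fv) + b k \<le> 0)))"


section \<open>The dual problem\<close>

definition bx :: "nat \<Rightarrow> nat option \<Rightarrow> real Matrix.vec" where
  "bx N i = (case i of
       None \<Rightarrow> unit_vec (2 * N + 2) (2 * N + 1)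
     | Some j \<Rightarrow> if j = 0 then 0\<^sub>v (2 * N + 2) else unit_vec (2 * N + 2) (N + j))"

definition bg :: "nat \<Rightarrow> nat option \<Rightarrow> real Matrix.vec" where
  "bg N i = (case i of None \<Rightarrow> 0\<^sub>v (2 * N + 2) | Some j \<Rightarrow> unit_vec (2 * N + 2) j)"

definition bf :: "nat \<Rightarrow> nat option \<Rightarrow> real Matrix.vec" where
  "bf N i = (case i of None \<Rightarrow> unit_vec (N + 2) (N + 1) | Some j \<Rightarrow> unit_vec (N + 2) j)"

definition outer :: "real Matrix.vec \<Rightarrow> real Matrix.vec \<Rightarrow> real Matrix.mat" where
  "outer x y = Matrix.mat (dim_vec x) (dim_vec y) (\<lambda>(p, q). vec_index x p * vec_index y q)"

definition sym_outer :: "real Matrix.vec \<Rightarrow> real Matrix.vec \<Rightarrow> real Matrix.mat" where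
  "sym_outer x y = (1/2) \<cdot>\<^sub>m (outer x y + outer y x)"

text \<open>No symmetry of the matrix is required.\<close>

definition psd :: "real Matrix.mat \<Rightarrow> bool" where
  "psd M \<longleftrightarrow> (\<forall>v \<in> carrier_vec (dim_row M). scalar_prod v (M *\<^sub>v v) \<ge> 0)"

text \<open>Finite sums of \<open>n \<times> n\<close> matrices, analogous to \<open>finsum_vec\<close>.\<close>

definition finsum_mat :: "nat \<Rightarrow> ('c \<Rightarrow> real Matrix.mat) \<Rightarrow> 'c set \<Rightarrow> real Matrix.mat" where
  "finsum_mat n M I = Matrix.mat n n (\<lambda>(p, q). \<Sum>i\<in>I. M i $$ (p, q))"

definition dual_matrix ::
    "nat \<Rightarrow> 'k set \<Rightarrow> ('k \<Rightarrow> real Matrix.mat) \<Rightarrow> ('k \<Rightarrow> real) \<Rightarrow>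
     (nat \<Rightarrow> nat \<Rightarrow> real) \<Rightarrow> (nat \<Rightarrow> nat \<Rightarrow> real) \<Rightarrow> real \<Rightarrow> real Matrix.mat" where
  "dual_matrix N K A \<alpha> \<beta> \<gamma> \<tau> =
     finsum_mat (2 * N + 2) (\<lambda>k. \<alpha> k \<cdot>\<^sub>m A k) K
     + finsum_mat (2 * N + 2)
         (\<lambda>i. sym_outer (bg N (Some i))
            (finsum_vec TYPE(real) (2 * N + 2) (\<lambda>j. \<beta> i j \<cdot>\<^sub>v bg N (Some j)) {0..<i}
             + finsum_vec TYPE(real) (2 * N + 2)
                 (\<lambda>j. \<gamma> i j \<cdot>\<^sub>v (bx N (Some j) - bx N (Some 0))) {1..i})) {1..N}
     + \<tau> \<cdot>\<^sub>m sym_outer (bx N (Some 0) - bx N None) (bx N (Some 0) - bx N None)"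

text \<open>
  The variables are total functions, of which only the values at the relevant indices
  (\<open>\<alpha> k\<close> for \<open>k \<in> K\<close>, \<open>\<beta> i j\<close> for \<open>0 \<le> j < i \<le> N\<close>, \<open>\<gamma> i j\<close> for \<open>1 \<le> j \<le> i \<le> N\<close>) matter.
\<close>

definition dual_feasible ::
    "nat \<Rightarrow> 'k set \<Rightarrow> ('k \<Rightarrow> real Matrix.mat) \<Rightarrow> ('k \<Rightarrow> real Matrix.vec) \<Rightarrow> ('k \<Rightarrow> real) \<Rightarrow>
     (nat \<Rightarrow> nat \<Rightarrow> real) \<Rightarrow> (nat \<Rightarrow> nat \<Rightarrow> real) \<Rightarrow> real \<Rightarrow> bool" where
  "dual_feasible N K A a \<alpha> \<beta> \<gamma> \<tau> \<longleftrightarrow>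
     (\<forall>k\<in>K. \<alpha> k \<ge> 0) \<and> \<tau> \<ge> 0 \<and>
     psd (dual_matrix N K A \<alpha> \<beta> \<gamma> \<tau>) \<and>
     bf N (Some N) - bf N None - finsum_vec TYPE(real) (N + 2) (\<lambda>k. \<alpha> k \<cdot>\<^sub>v a k) K = 0\<^sub>v (N + 2)"

text \<open>The value is \<open>\<infinity>\<close> if the problem is infeasible and \<open>-\<infinity>\<close> if it is unbounded below.\<close>

definition dual_value ::
    "nat \<Rightarrow> real \<Rightarrow> 'k set \<Rightarrow> ('k \<Rightarrow> real Matrix.mat) \<Rightarrow> ('k \<Rightarrow> real Matrix.vec) \<Rightarrow>
     ('k \<Rightarrow> real) \<Rightarrow> ereal" where
  "dual_value N R K A a b =
     Inf {ereal (\<tau> * R\<^sup>2 - (\<Sum>k\<in>K. \<alpha> k * b k)) | \<alpha> \<beta> \<gamma> \<tau>. dual_feasible N K A a \<alpha> \<beta> \<gamma> \<tau>}"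

text \<open>
  The bound \<open>V\<close> is attained up to any \<open>\<epsilon> > 0\<close>. If \<open>V = \<infinity>\<close>, where \<open>V - \<epsilon> = \<infinity>\<close> can never be
  reached by the finite quantity \<open>f y - min_value f\<close>, the corresponding meaning is that this
  quantity is unbounded over all inputs and outputs.
\<close>

definition tight_bound ::
    "nat \<Rightarrow> ('a::euclidean_space \<Rightarrow> ereal) set \<Rightarrow> real \<Rightarrow> ereal \<Rightarrow> bool" where
  "tight_bound N \<F> R V \<longleftrightarrow>
     (V \<noteq> \<infinity> \<longrightarrow>
        (\<forall>\<epsilon>>0. \<exists>f x0 y. is_input \<F> R f x0 \<and> gfom_output N f x0 y \<and>
                       f y - min_value f \<ge> V - ereal \<epsilon>)) \<and>
     (V = \<infinity> \<longrightarrow>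
        (\<forall>B. \<exists>f x0 y. is_input \<F> R f x0 \<and> gfom_output N f x0 y \<and>
                     f y - min_value f \<ge> ereal B))"

end

theory Submission
  imports Defs
begin

text \<open>
  The argument identifies the worst case of the method with a semidefinite program whose dual is
  \<open>(D)\<close>. Call data \<open>(x\<^sub>i, g\<^sub>i, f\<^sub>i)\<close> for \<open>i \<in> {*, 0, \<dots>, N}\<close> a relaxed run if they are interpolable,
  \<open>g\<^sub>* = 0\<close>, \<open>\<parallel>x\<^sub>0 - x\<^sub>*\<parallel> \<le> R\<close>, and each \<open>g\<^sub>i\<close> with \<open>i \<ge> 1\<close> is orthogonal to the earlier subgradients and to
  \<open>x\<^sub>1 - x\<^sub>0, \<dots>, x\<^sub>i - x\<^sub>0\<close>. All these conditions are affine in the Gram matrix of the data and in the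
  values. Every run of the method is a relaxed run, because \<open>x\<^sub>j - x\<^sub>0\<close> lies in the span of
  \<open>g\<^sub>0, \<dots>, g\<^sub>j\<^sub>-\<^sub>1\<close>. Pairing the Gram matrix with the positive semidefinite matrix of a dual feasible
  point gives the upper bound (\<open>relaxed_run_weak_duality\<close>).

  For tightness there are three further ingredients.

  \<^item> If the class is contraction-preserving, every relaxed run has the objective value of a true run
    (\<open>relaxed_run_realizable\<close>): project the points onto \<open>x\<^sub>0 + span {g\<^sub>0, \<dots>, g\<^sub>N}\<close>. The inner products
    with the subgradients survive, distances shrink, and orthogonality puts the projected
    \<open>x\<^sub>i - x\<^sub>0\<close> into \<open>span {g\<^sub>0, \<dots>, g\<^sub>i\<^sub>-\<^sub>1}\<close>.

  \<^item> The program has no duality gap (\<open>relaxed_run_strong_duality\<close>). Since \<open>d \<ge> 2N + 2\<close>, the Gram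
    matrices of \<open>2N + 2\<close> vectors of \<open>\<real>\<^sup>d\<close> form a convex cone. All other constraints are affine, so they
    are handled by Farkas' lemma, and Slater's condition is needed only for this cone
    (\<open>conic_strong_duality\<close>).

  \<^item> Slater's condition follows from the long run that does not reach an optimum
    (\<open>truncated_runs_nondegenerate\<close>). For \<open>k = 1, \<dots>, N + 1\<close> keep the first \<open>k\<close> points of that run and
    replace the later ones by the minimizer with subgradient \<open>0\<close>. Each of these is a relaxed run,
    although usually not a run. No nontrivial linear relation between the columns of \<open>P\<close> holds in
    all of them, so the average of their Gram matrices is positive definite.

  Consequently every upper bound for the relaxed runs is met by the objective of a dual feasible
  point, so \<open>val(D)\<close> is the supremum of \<open>f(x\<^sub>N) - f\<^sub>*\<close> over all inputs and outputs.
\<close>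

section \<open>Strong duality for affine constraints on a convex cone\<close>

text \<open>
  Induction on the number of constraints, after Bartl. If the new constraint \<open>\<phi> j\<close> is needed, some
  \<open>z\<close> violates only this one and has \<open>f z > 0\<close>. Moving every point along \<open>z\<close> into the kernel of \<open>\<phi> j\<close>
  eliminates this constraint, and the multiplier found for it is nonnegative by the signs at \<open>z\<close>.
  The relative version matters below because the identity between functionals is available on
  symmetric matrices only.
\<close>

lemma farkas_on_subspace:
  fixes f :: "'v::real_vector \<Rightarrow> real" and \<phi> :: "'i \<Rightarrow> 'v \<Rightarrow> real"
  assumes "finite I" "subspace W" "linear f" "\<And>i. i \<in> I \<Longrightarrow> linear (\<phi> i)"
    and "\<And>x. x \<in> W \<Longrightarrow> (\<forall>i\<in>I. \<phi> i x \<le> 0) \<Longrightarrow> f x \<le> 0"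
  shows "\<exists>\<alpha>. (\<forall>i\<in>I. \<alpha> i \<ge> 0) \<and> (\<forall>x\<in>W. f x = (\<Sum>i\<in>I. \<alpha> i * \<phi> i x))"
  using assms(1,3-)
proof (induction I arbitrary: f \<phi> rule: finite_induct)
  case empty
  have "f x = 0" if "x \<in> W" for x
    using empty(3)[OF that] empty(3)[OF subspace_neg[OF assms(2) that]] linear_neg[OF empty(1)] by simp
  then show ?case by auto
next
  case (insert j I)
  show ?case
  proof (cases "\<forall>x\<in>W. (\<forall>i\<in>I. \<phi> i x \<le> 0) \<longrightarrow> f x \<le> 0")
    case True
    then obtain \<alpha> where \<alpha>: "\<forall>i\<in>I. \<alpha> i \<ge> 0" "\<forall>x\<in>W. f x = (\<Sum>i\<in>I. \<alpha> i * \<phi> i x)"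
      using insert.IH[of f \<phi>] insert.prems by auto
    have "(\<Sum>i\<in>I. (\<alpha>(j := 0)) i * \<phi> i x) = (\<Sum>i\<in>I. \<alpha> i * \<phi> i x)" for x
      using insert.hyps by (intro sum.cong) auto
    then show ?thesis
      using \<alpha> insert.hyps by (intro exI[of _ "\<alpha>(j := 0)"]) auto
  next
    case False
    then obtain z' where z': "z' \<in> W" "\<forall>i\<in>I. \<phi> i z' \<le> 0" "f z' > 0" by force
    then have pos: "\<phi> j z' > 0"
      using insert.prems(3)[of z'] by force
    \<comment> \<open>scaled so that \<open>x - \<phi> j x *\<^sub>R z\<close> lies in the kernel of \<open>\<phi> j\<close>\<close>
    define z where "z = (1 / \<phi> j z') *\<^sub>R z'"
    have lf: "linear f" and lj: "linear (\<phi> j)" and l\<phi>: "\<And>i. i \<in> I \<Longrightarrow> linear (\<phi> i)"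
      using insert.prems by auto
    have z: "z \<in> W" "\<phi> j z = 1" "f z > 0" "\<And>i. i \<in> I \<Longrightarrow> \<phi> i z \<le> 0"
      using z' pos subspace_scale[OF assms(2)] linear_scale[OF lf] linear_scale[OF lj] linear_scale[OF l\<phi>]
      by (auto simp: z_def divide_nonpos_pos)
    define f' where "f' x = f x - f z * \<phi> j x" for x
    define \<psi> where "\<psi> i x = \<phi> i x - \<phi> i z * \<phi> j x" for i x
    have "linear f'"
      unfolding f'_def[abs_def]
      by (intro linear_compose_sub lf linear_compose_scale_right[OF lj, unfolded real_scaleR_def])
    moreover have "linear (\<psi> i)" if "i \<in> I" for i
      unfolding \<psi>_def[abs_def]
      by (intro linear_compose_sub l\<phi>[OF that] linear_compose_scale_right[OF lj, unfolded real_scaleR_def])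
    moreover have "f' x \<le> 0" if "x \<in> W" "\<forall>i\<in>I. \<psi> i x \<le> 0" for x
    proof -
      let ?y = "x - \<phi> j x *\<^sub>R z"
      have "?y \<in> W" using that z assms(2) by (simp add: subspace_diff subspace_scale)
      moreover have "\<forall>i\<in>insert j I. \<phi> i ?y \<le> 0"
        using that(2) z(2) linear_diff[OF lj] linear_scale[OF lj] linear_diff[OF l\<phi>] linear_scale[OF l\<phi>]
        by (auto simp: \<psi>_def mult.commute)
      ultimately have "f ?y \<le> 0" using insert.prems(3) by blast
      then show ?thesis
        using linear_diff[OF lf] linear_scale[OF lf] by (simp add: f'_def mult.commute)
    qed
    ultimately obtain \<alpha> where \<alpha>: "\<forall>i\<in>I. \<alpha> i \<ge> 0" "\<forall>x\<in>W. f' x = (\<Sum>i\<in>I. \<alpha> i * \<psi> i x)"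
      using insert.IH[of f' \<psi>] by auto
    define c where "c = f z - (\<Sum>i\<in>I. \<alpha> i * \<phi> i z)"
    have "(\<Sum>i\<in>I. \<alpha> i * \<phi> i z) \<le> 0"
      using \<alpha>(1) z(4) by (intro sum_nonpos) (simp add: mult_nonneg_nonpos)
    then have "c \<ge> 0" using z(3) by (simp add: c_def)
    moreover have "f x = (\<Sum>i\<in>insert j I. (\<alpha>(j := c)) i * \<phi> i x)" if "x \<in> W" for x
    proof -
      have "(\<Sum>i\<in>I. (\<alpha>(j := c)) i * \<phi> i x) = (\<Sum>i\<in>I. \<alpha> i * \<phi> i x)"
        using insert.hyps by (intro sum.cong) auto
      moreover have "f x - f z * \<phi> j x = (\<Sum>i\<in>I. \<alpha> i * \<phi> i x) - (\<Sum>i\<in>I. \<alpha> i * \<phi> i z) * \<phi> j x"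
        using \<alpha>(2) that unfolding f'_def \<psi>_def
        by (simp add: algebra_simps sum_subtractf sum_distrib_left)
      ultimately show ?thesis
        using insert.hyps by (simp add: c_def algebra_simps)
    qed
    ultimately show ?thesis
      using \<alpha>(1) by (intro exI[of _ "\<alpha>(j := c)"]) auto
  qed
qed

text \<open>
  Homogenization: a further coordinate \<open>s \<ge> 0\<close> multiplies the constants, and its own multiplier
  absorbs the slack, which turns the equation into an inequality. Points with \<open>s = 0\<close> are recession
  directions of the feasible set.
\<close>

lemma affine_farkas_on_subspace:
  fixes f :: "'v::real_vector \<Rightarrow> real" and \<phi> :: "'i \<Rightarrow> 'v \<Rightarrow> real"
  assumes fin: "finite I" and W: "subspace W" and lf: "linear f" and l\<phi>: "\<And>i. i \<in> I \<Longrightarrow> linear (\<phi> i)"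
    and z: "z \<in> W" "\<forall>i\<in>I. \<phi> i z + b i \<le> 0"
    and le: "\<And>x. x \<in> W \<Longrightarrow> \<forall>i\<in>I. \<phi> i x + b i \<le> 0 \<Longrightarrow> f x \<le> B"
  shows "\<exists>\<alpha>. (\<forall>i\<in>I. \<alpha> i \<ge> 0) \<and> (\<forall>x\<in>W. f x - B \<le> (\<Sum>i\<in>I. \<alpha> i * (\<phi> i x + b i)))"
proof -
  define W' where "W' = W \<times> (UNIV :: real set)"
  define F where "F = (\<lambda>(x, s). f x - B * s)"
  define \<Phi> where "\<Phi> = (\<lambda>i (x, s). case i of None \<Rightarrow> - s | Some j \<Rightarrow> \<phi> j x + b j * s)"
  have "subspace W'" unfolding W'_def by (intro subspace_Times W subspace_UNIV)
  moreover have "linear F"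
    unfolding F_def using linear_add[OF lf] linear_scale[OF lf]
    by (intro linearI) (auto simp: algebra_simps)
  moreover have "linear (\<Phi> i)" if "i \<in> insert None (Some ` I)" for i
    using that linear_add[OF l\<phi>] linear_scale[OF l\<phi>]
    by (intro linearI) (auto simp: \<Phi>_def algebra_simps)
  moreover have "F p \<le> 0" if "p \<in> W'" "\<forall>i\<in>insert None (Some ` I). \<Phi> i p \<le> 0" for p
  proof -
    obtain x s where p: "p = (x, s)" by force
    have x: "x \<in> W" and s: "s \<ge> 0" and hom: "\<And>i. i \<in> I \<Longrightarrow> \<phi> i x + b i * s \<le> 0"
      using that by (auto simp: p W'_def \<Phi>_def)
    show ?thesis
    proof (cases "s = 0")
      case True
      \<comment> \<open>x is a direction in which the feasible set recedes, so f cannot increase along it\<close>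
      have "f z + t * f x \<le> B" if "t \<ge> 0" for t
      proof -
        have "z + t *\<^sub>R x \<in> W" using x z(1) W by (simp add: subspace_add subspace_scale)
        moreover have "\<phi> i (z + t *\<^sub>R x) + b i \<le> 0" if "i \<in> I" for i
          using z(2) hom[OF that] True that \<open>t \<ge> 0\<close> linear_add[OF l\<phi>[OF that]] linear_scale[OF l\<phi>[OF that]]
            mult_nonneg_nonpos[of t "\<phi> i x"] by force
        ultimately show ?thesis
          using le[of "z + t *\<^sub>R x"] linear_add[OF lf] linear_scale[OF lf] by simp
      qed
      from this[of "(B - f z + 1) / f x"] this[of 0] have "\<not> f x > 0"
        by (auto simp: field_simps)
      then show ?thesis using True by (simp add: p F_def)
    next
      case False
      then have s: "s > 0" using s by simp
      have "(1 / s) *\<^sub>R x \<in> W" using x W by (simp add: subspace_scale)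
      moreover have "\<phi> i ((1 / s) *\<^sub>R x) + b i \<le> 0" if "i \<in> I" for i
        using hom[OF that] s linear_scale[OF l\<phi>[OF that]] by (simp add: field_simps)
      ultimately have "f ((1 / s) *\<^sub>R x) \<le> B" using le by blast
      then show ?thesis
        using s linear_scale[OF lf] by (simp add: p F_def field_simps)
    qed
  qed
  ultimately obtain \<alpha> where \<alpha>: "\<forall>i\<in>insert None (Some ` I). \<alpha> i \<ge> 0"
      "\<forall>p\<in>W'. F p = (\<Sum>i\<in>insert None (Some ` I). \<alpha> i * \<Phi> i p)"
    using farkas_on_subspace[of "insert None (Some ` I)" W' F \<Phi>] fin by auto
  have "f x - B \<le> (\<Sum>i\<in>I. \<alpha> (Some i) * (\<phi> i x + b i))" if "x \<in> W" for x
  proof -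
    have "F (x, 1) = (\<Sum>i\<in>insert None (Some ` I). \<alpha> i * \<Phi> i (x, 1))"
      using \<alpha>(2) that by (auto simp: W'_def)
    also have "\<dots> = - \<alpha> None + (\<Sum>i\<in>I. \<alpha> (Some i) * (\<phi> i x + b i))"
      using fin by (simp add: sum.reindex \<Phi>_def)
    finally show ?thesis using \<alpha>(1) by (simp add: F_def)
  qed
  then show ?thesis using \<alpha>(1) by (intro exI[of _ "\<lambda>i. \<alpha> (Some i)"]) auto
qed

text \<open>
  Hypothesis \<open>slater\<close> says that \<open>z\<close> is in the relative interior of \<open>C\<close>: a functional that is
  nonnegative on \<open>C\<close> but not positive at \<open>z\<close> vanishes on \<open>C\<close>. The set \<open>D\<close> of all pairs \<open>(x - s, t)\<close>, where
  \<open>x\<close> in the span of \<open>C\<close> meets the affine constraints, \<open>s \<in> C\<close> and \<open>t < c x - B\<close>, avoids \<open>0\<close> exactly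
  because \<open>B\<close> is an upper bound. A hyperplane separating \<open>0\<close> from \<open>D\<close> trades membership in \<open>C\<close> for a
  functional \<open>m\<close> that is nonnegative on \<open>C\<close>. It is not vertical by the condition on \<open>z\<close>, so \<open>c\<close> plus a
  multiple of \<open>m\<close> is bounded by \<open>B\<close> under the affine constraints alone, and Farkas' lemma applies.
\<close>

lemma conic_strong_duality:
  fixes C :: "'v::euclidean_space set" and c :: "'v \<Rightarrow> real" and \<phi> :: "'i \<Rightarrow> 'v \<Rightarrow> real"
  assumes add: "\<And>x y. x \<in> C \<Longrightarrow> y \<in> C \<Longrightarrow> x + y \<in> C"
    and scale: "\<And>x t. x \<in> C \<Longrightarrow> t \<ge> 0 \<Longrightarrow> t *\<^sub>R x \<in> C"
    and fin: "finite I" and lc: "linear c" and l\<phi>: "\<And>i. i \<in> I \<Longrightarrow> linear (\<phi> i)"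
    and z: "z \<in> C" "\<forall>i\<in>I. \<phi> i z + b i \<le> 0"
    and slater: "\<And>m x. \<forall>y\<in>C. inner m y \<ge> 0 \<Longrightarrow> inner m z \<le> 0 \<Longrightarrow> x \<in> C \<Longrightarrow> inner m x = 0"
    and le: "\<And>x. x \<in> C \<Longrightarrow> \<forall>i\<in>I. \<phi> i x + b i \<le> 0 \<Longrightarrow> c x \<le> B"
  shows "\<exists>\<alpha>. (\<forall>i\<in>I. \<alpha> i \<ge> 0) \<and> (\<forall>x\<in>C. c x - B \<le> (\<Sum>i\<in>I. \<alpha> i * (\<phi> i x + b i)))"
proof -
  define W where "W = span C"
  define L where "L = {x \<in> W. \<forall>i\<in>I. \<phi> i x + b i \<le> 0}"
  define D where "D = {(x - s, t) | x s t. x \<in> L \<and> s \<in> C \<and> t < c x - B}"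
  have W: "subspace W" by (simp add: W_def)
  have CW: "C \<subseteq> W" by (simp add: W_def span_superset)
  have zW: "z \<in> W" using z(1) CW by blast
  have zC: "0 \<in> C" using scale[OF z(1), of 0] by simp
  have zL: "z \<in> L" using z CW by (auto simp: L_def)
  have convL: "u *\<^sub>R x + v *\<^sub>R y \<in> L" if "x \<in> L" "y \<in> L" "u \<ge> 0" "v \<ge> 0" "u + v = 1" for x y u v
  proof -
    have "\<phi> i (u *\<^sub>R x + v *\<^sub>R y) + b i \<le> 0" if "i \<in> I" for i
    proof -
      have "\<phi> i (u *\<^sub>R x + v *\<^sub>R y) + b i = u * \<phi> i x + v * \<phi> i y + (u + v) * b i"
        using linear_add[OF l\<phi>[OF that]] linear_scale[OF l\<phi>[OF that]] \<open>u + v = 1\<close> by simp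
      also have "\<dots> = u * (\<phi> i x + b i) + v * (\<phi> i y + b i)" by (simp add: algebra_simps)
      also have "\<dots> \<le> 0"
        using \<open>x \<in> L\<close> \<open>y \<in> L\<close> \<open>u \<ge> 0\<close> \<open>v \<ge> 0\<close> that
          mult_nonneg_nonpos[of u "\<phi> i x + b i"] mult_nonneg_nonpos[of v "\<phi> i y + b i"]
        by (simp add: L_def)
      finally show ?thesis .
    qed
    then show ?thesis using that W by (auto simp: L_def subspace_add subspace_scale)
  qed
  have convD: "convex D"
  proof (rule convexI)
    fix p q :: "'v \<times> real" and u v :: real
    assume pq: "p \<in> D" "q \<in> D" and uv: "0 \<le> u" "0 \<le> v" "u + v = 1"
    obtain x s t where p: "p = (x - s, t)" "x \<in> L" "s \<in> C" "t < c x - B" using pq by (auto simp: D_def)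
    obtain x' s' t' where q: "q = (x' - s', t')" "x' \<in> L" "s' \<in> C" "t' < c x' - B" using pq by (auto simp: D_def)
    have "u * t + v * t' < u * (c x - B) + v * (c x' - B)"
    proof (cases "u = 0")
      case True then show ?thesis using uv q by simp
    next
      case False
      then have "u * t < u * (c x - B)" using p uv by simp
      moreover have "v * t' \<le> v * (c x' - B)" using q uv by (simp add: mult_left_mono)
      ultimately show ?thesis by linarith
    qed
    also have "\<dots> = u * c x + v * c x' - (u + v) * B" by (simp add: algebra_simps)
    also have "\<dots> = c (u *\<^sub>R x + v *\<^sub>R x') - B"
      using linear_add[OF lc] linear_scale[OF lc] uv by simp
    finally have "u * t + v * t' < c (u *\<^sub>R x + v *\<^sub>R x') - B" .
    moreover have "u *\<^sub>R p + v *\<^sub>R q = ((u *\<^sub>R x + v *\<^sub>R x') - (u *\<^sub>R s + v *\<^sub>R s'), u * t + v * t')"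
      by (simp add: p q algebra_simps)
    moreover have "u *\<^sub>R s + v *\<^sub>R s' \<in> C" using add scale p q uv by blast
    ultimately show "u *\<^sub>R p + v *\<^sub>R q \<in> D"
      using convL[OF p(2) q(2) uv] unfolding D_def by blast
  qed
  have D0: "0 \<notin> D"
  proof
    assume "0 \<in> D"
    then obtain x where "x \<in> L" "x \<in> C" "0 < c x - B" by (auto simp: D_def zero_prod_def)
    then show False using le[of x] by (auto simp: L_def)
  qed
  have "(z - 0, c z - B - 1) \<in> D" using zL zC unfolding D_def by force
  then have Dne: "D \<noteq> {}" by blast
  obtain a where a: "a \<in> span D" "a \<noteq> 0" "\<And>p. p \<in> D \<Longrightarrow> 0 \<le> inner a p"
    using separating_hyperplane_set_0_inspan[OF convD Dne D0] by blast
  define m \<mu> where "m = - fst a" and "\<mu> = - snd a"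
  have sep: "inner m x + \<mu> * t \<le> inner m s" if "x \<in> L" "s \<in> C" "t < c x - B" for x s t
  proof -
    have "(x - s, t) \<in> D" using that by (auto simp: D_def)
    from a(3)[OF this] show ?thesis
      by (simp add: inner_prod_def m_def \<mu>_def inner_diff_right)
  qed
  have \<mu>: "\<mu> \<ge> 0"
  proof (rule ccontr)
    assume "\<not> \<mu> \<ge> 0"
    define t where "t = min (c z - B - 1) ((- inner m z + 1) / \<mu>)"
    have "inner m z + \<mu> * t \<le> 0" using sep[OF zL zC, of t] by (simp add: t_def)
    moreover have "\<mu> * t \<ge> \<mu> * ((- inner m z + 1) / \<mu>)"
      using \<open>\<not> \<mu> \<ge> 0\<close> by (intro mult_left_mono_neg) (auto simp: t_def)
    ultimately show False using \<open>\<not> \<mu> \<ge> 0\<close> by simp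
  qed
  have mC: "inner m s \<ge> 0" if "s \<in> C" for s
  proof (rule ccontr)
    assume neg: "\<not> inner m s \<ge> 0"
    define r where "r = inner m z + \<mu> * (c z - B - 1)"
    have "r \<le> inner m ((max 0 ((r - 1) / inner m s)) *\<^sub>R s)"
      unfolding r_def by (rule sep[OF zL scale[OF that]]) auto
    moreover have "\<dots> \<le> ((r - 1) / inner m s) * inner m s"
      using neg by (simp only: inner_scaleR_right) (intro mult_right_mono_neg, auto)
    ultimately show False using neg by simp
  qed
  have upper: "inner m x + \<mu> * (c x - B) \<le> 0" if "x \<in> L" for x
  proof (rule field_le_epsilon)
    fix e :: real assume "e > 0"
    have "inner m x + \<mu> * (c x - B - e / (\<mu> + 1)) \<le> 0"
      using sep[OF that zC, of "c x - B - e / (\<mu> + 1)"] \<open>e > 0\<close> \<mu> by simp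
    moreover have "\<mu> * (e / (\<mu> + 1)) \<le> e" using \<mu> \<open>e > 0\<close> by (simp add: field_simps)
    ultimately show "inner m x + \<mu> * (c x - B) \<le> 0 + e" by (simp add: algebra_simps)
  qed
  \<comment> \<open>a vertical hyperplane would have \<open>m\<close> orthogonal to \<open>C\<close>, while \<open>m\<close> lies in the span of \<open>C\<close>\<close>
  have "\<mu> \<noteq> 0"
  proof
    assume "\<mu> = 0"
    then have "inner m z \<le> 0" using upper[OF zL] by simp
    then have "inner m x = 0" if "x \<in> C" for x using slater mC that by blast
    then have orth: "inner m x = 0" if "x \<in> W" for x
      using span_induct[OF that[unfolded W_def], of "\<lambda>x. inner m x = 0"]
      by (auto simp: subspace_def inner_add_right)
    have "D \<subseteq> W \<times> UNIV" using CW W by (auto simp: D_def L_def intro: subspace_diff)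
    then have "span D \<subseteq> W \<times> UNIV" by (intro span_minimal subspace_Times W subspace_UNIV)
    then have "m \<in> W" using a(1) W by (auto simp: m_def subspace_neg mem_Times_iff)
    then have "m = 0" using orth by force
    then show False using \<open>\<mu> = 0\<close> a(2) by (simp add: m_def \<mu>_def prod_eq_iff)
  qed
  then have \<mu>: "\<mu> > 0" using \<mu> by simp
  define f where "f x = inner m x / \<mu> + c x" for x
  have lf: "linear f"
    using linear_add[OF lc] linear_scale[OF lc] unfolding f_def
    by (intro linearI) (auto simp: inner_add_right algebra_simps add_divide_distrib)
  have fB: "f x \<le> B" if "x \<in> W" "\<forall>i\<in>I. \<phi> i x + b i \<le> 0" for x
    using upper[of x] that \<mu> by (simp add: f_def L_def field_simps)
  have "\<exists>\<alpha>. (\<forall>i\<in>I. \<alpha> i \<ge> 0) \<and> (\<forall>x\<in>W. f x - B \<le> (\<Sum>i\<in>I. \<alpha> i * (\<phi> i x + b i)))"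
    by (rule affine_farkas_on_subspace[OF fin W lf l\<phi> zW z(2) fB])
  then obtain \<alpha> where \<alpha>: "\<forall>i\<in>I. \<alpha> i \<ge> 0"
      "\<forall>x\<in>W. f x - B \<le> (\<Sum>i\<in>I. \<alpha> i * (\<phi> i x + b i))"
    by blast
  have "c x - B \<le> (\<Sum>i\<in>I. \<alpha> i * (\<phi> i x + b i))" if "x \<in> C" for x
  proof -
    have "c x - B \<le> f x - B" using mC[OF that] \<mu> by (simp add: f_def)
    also have "\<dots> \<le> (\<Sum>i\<in>I. \<alpha> i * (\<phi> i x + b i))" using \<alpha>(2) that CW by blast
    finally show ?thesis .
  qed
  then show ?thesis using \<alpha>(1) by blast
qed

section \<open>Quadratic forms and the dual matrix\<close>

text \<open>
  For symmetric \<open>H\<close> this is the trace of \<open>M H\<close>. Taking \<open>H\<close> as a function allows Gram matrices and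
  the rank-one matrices \<open>v v\<^sup>T\<close> to be inserted directly.
\<close>

definition mat_form :: "real Matrix.mat \<Rightarrow> (nat \<Rightarrow> nat \<Rightarrow> real) \<Rightarrow> real" where
  "mat_form M H = (\<Sum>p<dim_row M. \<Sum>q<dim_col M. M $$ (p, q) * H p q)"

lemma mat_form_carrier:
  "M \<in> carrier_mat n n \<Longrightarrow> mat_form M H = (\<Sum>p<n. \<Sum>q<n. M $$ (p, q) * H p q)"
  by (auto simp: mat_form_def)

lemma mat_form_add:
  assumes "M \<in> carrier_mat n n" "M' \<in> carrier_mat n n"
  shows "mat_form (M + M') H = mat_form M H + mat_form M' H"
  using assms by (simp add: mat_form_def sum.distrib distrib_right)

lemma mat_form_smult: "mat_form (c \<cdot>\<^sub>m M) H = c * mat_form M H"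
  by (simp add: mat_form_def sum_distrib_left mult.assoc)

lemma finsum_mat_carrier [simp]: "finsum_mat n M I \<in> carrier_mat n n"
  by (simp add: finsum_mat_def)

lemma mat_form_finsum_mat:
  assumes "\<And>i. i \<in> I \<Longrightarrow> M i \<in> carrier_mat n n"
  shows "mat_form (finsum_mat n M I) H = (\<Sum>i\<in>I. mat_form (M i) H)"
proof -
  have "mat_form (finsum_mat n M I) H = (\<Sum>p<n. \<Sum>q<n. \<Sum>i\<in>I. M i $$ (p, q) * H p q)"
    by (simp add: mat_form_def finsum_mat_def sum_distrib_right)
  also have "\<dots> = (\<Sum>p<n. \<Sum>i\<in>I. \<Sum>q<n. M i $$ (p, q) * H p q)"
    by (intro sum.cong refl sum.swap)
  also have "\<dots> = (\<Sum>i\<in>I. \<Sum>p<n. \<Sum>q<n. M i $$ (p, q) * H p q)"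
    by (rule sum.swap)
  finally show ?thesis
    by (simp add: mat_form_carrier[OF assms])
qed

lemma sym_outer_carrier:
  assumes "x \<in> carrier_vec n" "y \<in> carrier_vec n"
  shows "sym_outer x y \<in> carrier_mat n n"
  using assms by (simp add: sym_outer_def outer_def)

lemma mat_form_sym_outer:
  assumes "x \<in> carrier_vec n" "y \<in> carrier_vec n" and sym: "\<And>p q. H p q = H q p"
  shows "mat_form (sym_outer x y) H = (\<Sum>p<n. \<Sum>q<n. vec_index x p * vec_index y q * H p q)"
proof -
  have "mat_form (sym_outer x y) H =
      (\<Sum>p<n. \<Sum>q<n. 1/2 * (vec_index x p * vec_index y q * H p q) + 1/2 * (vec_index y p * vec_index x q * H p q))"
    using assms by (auto simp: mat_form_def sym_outer_def outer_def algebra_simps intro!: sum.cong)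
  also have "\<dots> = 1/2 * (\<Sum>p<n. \<Sum>q<n. vec_index x p * vec_index y q * H p q)
      + 1/2 * (\<Sum>p<n. \<Sum>q<n. vec_index y p * vec_index x q * H p q)"
    by (simp add: sum.distrib sum_distrib_left)
  also have "(\<Sum>p<n. \<Sum>q<n. vec_index y p * vec_index x q * H p q) =
      (\<Sum>q<n. \<Sum>p<n. vec_index y p * vec_index x q * H p q)"
    by (rule sum.swap)
  also have "\<dots> = (\<Sum>p<n. \<Sum>q<n. vec_index x p * vec_index y q * H p q)"
    by (intro sum.cong refl) (use sym in \<open>simp add: mult_ac\<close>)
  finally show ?thesis by simp
qed

lemma mat_form_sym_outer_unit:
  assumes "i < n" "y \<in> carrier_vec n" and sym: "\<And>p q. H p q = H q p"
  shows "mat_form (sym_outer (unit_vec n i) y) H = (\<Sum>q<n. vec_index y q * H i q)"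
proof -
  have "mat_form (sym_outer (unit_vec n i) y) H =
      (\<Sum>p<n. if p = i then (\<Sum>q<n. vec_index y q * H p q) else 0)"
    by (subst mat_form_sym_outer[where n = n, OF unit_vec_carrier assms(2) sym], intro sum.cong refl)
      (use assms(1) in auto)
  then show ?thesis using assms(1) by simp
qed

lemma bg_Some: "bg N (Some j) = unit_vec (2 * N + 2) j"
  by (simp add: bg_def)

lemma bx_diff:
  assumes "1 \<le> j"
  shows "bx N (Some j) - bx N (Some 0) = unit_vec (2 * N + 2) (N + j)"
  using assms by (auto simp: bx_def)

lemma finsum_vec_unit_form:
  assumes "finite J" and u: "\<And>j. j \<in> J \<Longrightarrow> u j = unit_vec n (h j) \<and> h j < n"
  shows "(\<Sum>q<n. vec_index (finsum_vec TYPE(real) n (\<lambda>j. c j \<cdot>\<^sub>v u j) J) q * w q)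
       = (\<Sum>j\<in>J. c j * w (h j))"
proof -
  have "(\<Sum>q<n. vec_index (finsum_vec TYPE(real) n (\<lambda>j. c j \<cdot>\<^sub>v u j) J) q * w q)
      = (\<Sum>q<n. \<Sum>j\<in>J. (if q = h j then c j * w (h j) else 0))"
  proof (intro sum.cong refl)
    fix q assume q: "q \<in> {..<n}"
    have "(\<lambda>j. c j \<cdot>\<^sub>v u j) \<in> J \<rightarrow> carrier_vec n" using u by auto
    then have "vec_index (finsum_vec TYPE(real) n (\<lambda>j. c j \<cdot>\<^sub>v u j) J) q = (\<Sum>j\<in>J. vec_index (c j \<cdot>\<^sub>v u j) q)"
      using q assms(1) by (intro index_finsum_vec) auto
    also have "\<dots> = (\<Sum>j\<in>J. if q = h j then c j else 0)"
      using u q by (intro sum.cong) auto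
    finally show "vec_index (finsum_vec TYPE(real) n (\<lambda>j. c j \<cdot>\<^sub>v u j) J) q * w q
      = (\<Sum>j\<in>J. (if q = h j then c j * w (h j) else 0))"
      by (auto simp: sum_distrib_right intro!: sum.cong)
  qed
  also have "\<dots> = (\<Sum>j\<in>J. \<Sum>q<n. (if q = h j then c j * w (h j) else 0))"
    by (rule sum.swap)
  finally show ?thesis using u by simp
qed

lemma dual_matrix_carrier: "dual_matrix N K A \<alpha> \<beta> \<gamma> \<tau> \<in> carrier_mat (2 * N + 2) (2 * N + 2)"
proof -
  have "bx N (Some 0) - bx N None \<in> carrier_vec (2 * N + 2)" by (simp add: bx_def)
  then show ?thesis
    unfolding dual_matrix_def by (intro add_carrier_mat smult_carrier_mat finsum_mat_carrier sym_outer_carrier)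
qed

text \<open>
  With \<open>H\<close> the Gram matrix of the columns of \<open>P\<close>, each multiplier meets the quantity constrained by
  the method: \<open>\<beta> i j\<close> multiplies \<open>\<langle>g\<^sub>i, g\<^sub>j\<rangle>\<close>, \<open>\<gamma> i j\<close> multiplies \<open>\<langle>g\<^sub>i, x\<^sub>j - x\<^sub>0\<rangle>\<close>, and \<open>\<tau>\<close> multiplies
  \<open>\<parallel>x\<^sub>* - x\<^sub>0\<parallel>\<^sup>2\<close>. The two halves of each symmetrized product agree on a symmetric \<open>H\<close>.
\<close>

lemma mat_form_dual_matrix:
  assumes A: "\<And>k. k \<in> K \<Longrightarrow> A k \<in> carrier_mat (2 * N + 2) (2 * N + 2)"
    and sym: "\<And>p q. H p q = H q p"
  shows "mat_form (dual_matrix N K A \<alpha> \<beta> \<gamma> \<tau>) H =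
      (\<Sum>k\<in>K. \<alpha> k * mat_form (A k) H)
    + (\<Sum>i=1..N. (\<Sum>j<i. \<beta> i j * H i j) + (\<Sum>j=1..i. \<gamma> i j * H i (N + j)))
    + \<tau> * H (2 * N + 1) (2 * N + 1)"
proof -
  let ?n = "2 * N + 2"
  define w where "w i = finsum_vec TYPE(real) ?n (\<lambda>j. \<beta> i j \<cdot>\<^sub>v bg N (Some j)) {0..<i}
     + finsum_vec TYPE(real) ?n (\<lambda>j. \<gamma> i j \<cdot>\<^sub>v (bx N (Some j) - bx N (Some 0))) {1..i}" for i
  define z where "z = bx N (Some 0) - bx N None"
  have z: "z \<in> carrier_vec ?n" by (simp add: z_def bx_def)
  let ?B = "\<lambda>i. finsum_vec TYPE(real) ?n (\<lambda>j. \<beta> i j \<cdot>\<^sub>v bg N (Some j)) {0..<i}"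
  let ?C = "\<lambda>i. finsum_vec TYPE(real) ?n (\<lambda>j. \<gamma> i j \<cdot>\<^sub>v (bx N (Some j) - bx N (Some 0))) {1..i}"
  have c1: "?B i \<in> carrier_vec ?n" for i
    by (rule finsum_vec_closed) (auto simp: bg_Some)
  have c2: "?C i \<in> carrier_vec ?n" for i
    by (rule finsum_vec_closed) (auto simp: bx_diff)
  have w: "w i \<in> carrier_vec ?n" for i
    unfolding w_def using c1 c2 by (intro add_carrier_vec)
  have "mat_form (sym_outer (bg N (Some i)) (w i)) H
      = (\<Sum>j<i. \<beta> i j * H i j) + (\<Sum>j=1..i. \<gamma> i j * H i (N + j))" if "i \<in> {1..N}" for i
  proof -
    have "mat_form (sym_outer (bg N (Some i)) (w i)) H = (\<Sum>q<?n. vec_index (w i) q * H i q)"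
      unfolding bg_Some using that w sym by (intro mat_form_sym_outer_unit) auto
    also have "\<dots> = (\<Sum>q<?n. vec_index (?B i) q * H i q) + (\<Sum>q<?n. vec_index (?C i) q * H i q)"
      unfolding w_def
      by (subst sum.distrib[symmetric], intro sum.cong refl)
        (use c1[of i] c2[of i] in \<open>simp add: distrib_right\<close>)
    also have "(\<Sum>q<?n. vec_index (?B i) q * H i q) = (\<Sum>j\<in>{0..<i}. \<beta> i j * H i j)"
      using that by (intro finsum_vec_unit_form) (auto simp: bg_Some)
    also have "(\<Sum>q<?n. vec_index (?C i) q * H i q) = (\<Sum>j\<in>{1..i}. \<gamma> i j * H i (N + j))"
      using that by (intro finsum_vec_unit_form) (auto simp: bx_diff)
    finally show ?thesis by (simp add: atLeast0LessThan)
  qed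
  moreover have "mat_form (sym_outer z z) H = H (2 * N + 1) (2 * N + 1)"
  proof -
    have zi: "vec_index z p = (if p = 2 * N + 1 then -1 else 0)" if "p < ?n" for p
      using that by (simp add: z_def bx_def)
    have "mat_form (sym_outer z z) H = (\<Sum>p<?n. \<Sum>q<?n. vec_index z p * vec_index z q * H p q)"
      by (rule mat_form_sym_outer[OF z z sym])
    also have "\<dots> = (\<Sum>p<?n. if p = 2 * N + 1 then (\<Sum>q<?n. if q = 2 * N + 1 then H p q else 0) else 0)"
      by (intro sum.cong refl) (auto simp: zi intro!: sum.cong)
    finally show ?thesis by simp
  qed
  moreover have "mat_form (dual_matrix N K A \<alpha> \<beta> \<gamma> \<tau>) H =
      (\<Sum>k\<in>K. \<alpha> k * mat_form (A k) H)
    + (\<Sum>i=1..N. mat_form (sym_outer (bg N (Some i)) (w i)) H) + \<tau> * mat_form (sym_outer z z) H"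
  proof -
    let ?S1 = "finsum_mat ?n (\<lambda>k. \<alpha> k \<cdot>\<^sub>m A k) K"
    let ?S2 = "finsum_mat ?n (\<lambda>i. sym_outer (bg N (Some i)) (w i)) {1..N}"
    have zz: "\<tau> \<cdot>\<^sub>m sym_outer z z \<in> carrier_mat ?n ?n"
      using sym_outer_carrier[OF z z] by simp
    have "mat_form (dual_matrix N K A \<alpha> \<beta> \<gamma> \<tau>) H = mat_form (?S1 + ?S2 + \<tau> \<cdot>\<^sub>m sym_outer z z) H"
      by (simp only: dual_matrix_def w_def z_def)
    also have "\<dots> = mat_form ?S1 H + mat_form ?S2 H + mat_form (\<tau> \<cdot>\<^sub>m sym_outer z z) H"
      by (simp only: mat_form_add[OF add_carrier_mat[OF finsum_mat_carrier] zz]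
        mat_form_add[OF finsum_mat_carrier finsum_mat_carrier])
    also have "mat_form ?S1 H = (\<Sum>k\<in>K. mat_form (\<alpha> k \<cdot>\<^sub>m A k) H)"
      using A by (intro mat_form_finsum_mat) simp
    also have "mat_form ?S2 H = (\<Sum>i=1..N. mat_form (sym_outer (bg N (Some i)) (w i)) H)"
      by (intro mat_form_finsum_mat sym_outer_carrier w) (simp add: bg_Some)
    finally show ?thesis by (simp only: mat_form_smult)
  qed
  ultimately show ?thesis by simp
qed

lemma psd_iff_mat_form:
  assumes M: "M \<in> carrier_mat n n"
  shows "psd M \<longleftrightarrow> (\<forall>v. mat_form M (\<lambda>p q. v p * v q) \<ge> 0)"
proof -
  have eq: "scalar_prod u (M *\<^sub>v u) = mat_form M (\<lambda>p q. vec_index u p * vec_index u q)" if "u \<in> carrier_vec n" for u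
    using M that unfolding mat_form_carrier[OF M]
    by (auto simp: scalar_prod_def sum_distrib_left atLeast0LessThan mult_ac intro!: sum.cong)
  have eq2: "mat_form M (\<lambda>p q. v p * v q) = mat_form M (\<lambda>p q. vec_index (Matrix.vec n v) p * vec_index (Matrix.vec n v) q)" for v
    unfolding mat_form_carrier[OF M] by (intro sum.cong refl) auto
  show ?thesis
  proof
    assume "psd M"
    then have "mat_form M (\<lambda>p q. vec_index u p * vec_index u q) \<ge> 0" if "u \<in> carrier_vec n" for u
      using M eq that by (auto simp: psd_def)
    then show "\<forall>v. mat_form M (\<lambda>p q. v p * v q) \<ge> 0"
      using eq2 by (metis vec_carrier)
  next
    assume "\<forall>v. mat_form M (\<lambda>p q. v p * v q) \<ge> 0"
    then show "psd M" using M eq by (auto simp: psd_def)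
  qed
qed

text \<open>
  A Gram matrix is the sum, over the coordinates \<open>e\<close>, of the rank-one matrices of the vectors
  \<open>(\<langle>P p, e\<rangle>)\<^sub>p\<close>.
\<close>

lemma mat_form_gram_nonneg:
  fixes P :: "nat \<Rightarrow> 'a::euclidean_space"
  assumes M: "M \<in> carrier_mat n n" and "psd M"
  shows "mat_form M (\<lambda>p q. inner (P p) (P q)) \<ge> 0"
proof -
  have "mat_form M (\<lambda>p q. inner (P p) (P q)) =
      (\<Sum>p<n. \<Sum>q<n. \<Sum>e\<in>Basis. M $$ (p, q) * (inner (P p) e * inner (P q) e))"
    unfolding mat_form_carrier[OF M] by (subst euclidean_inner) (simp add: sum_distrib_left)
  also have "\<dots> = (\<Sum>p<n. \<Sum>e\<in>Basis. \<Sum>q<n. M $$ (p, q) * (inner (P p) e * inner (P q) e))"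
    by (intro sum.cong refl sum.swap)
  also have "\<dots> = (\<Sum>e\<in>Basis. mat_form M (\<lambda>p q. inner (P p) e * inner (P q) e))"
    unfolding mat_form_carrier[OF M] by (rule sum.swap)
  also have "\<dots> \<ge> 0"
    using assms psd_iff_mat_form[OF M] by (intro sum_nonneg) auto
  finally show ?thesis .
qed

lemma mat_trace_times_gram:
  assumes "M \<in> carrier_mat (2 * N + 2) (2 * N + 2)"
  shows "mat_trace (M * gram_mat N x g) = mat_form M (\<lambda>p q. inner (P_col N x g p) (P_col N x g q))"
  using assms unfolding mat_form_carrier[OF assms]
  by (auto simp: mat_trace_def gram_mat_def scalar_prod_def atLeast0LessThan inner_commute intro!: sum.cong)

lemma scalar_prod_value_vec:
  "scalar_prod v (value_vec N fv) = (\<Sum>p<N + 2. vec_index v p * (if p \<le> N then fv (Some p) else fv None))"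
  by (auto simp: scalar_prod_def value_vec_def atLeast0LessThan intro!: sum.cong)

text \<open>
  The entries \<open>N\<close> and \<open>N + 1\<close> belong to \<open>f\<^sub>N\<close> and \<open>f\<^sub>*\<close>.
\<close>

lemma dual_equation_iff:
  assumes a: "\<And>k. k \<in> K \<Longrightarrow> a k \<in> carrier_vec (N + 2)" and "finite K"
  shows "bf N (Some N) - bf N None - finsum_vec TYPE(real) (N + 2) (\<lambda>k. \<alpha> k \<cdot>\<^sub>v a k) K = 0\<^sub>v (N + 2) \<longleftrightarrow>
     (\<forall>p<N + 2. (\<Sum>k\<in>K. \<alpha> k * vec_index (a k) p) = (if p = N then 1 else if p = N + 1 then -1 else 0))"
proof -
  have c: "finsum_vec TYPE(real) (N + 2) (\<lambda>k. \<alpha> k \<cdot>\<^sub>v a k) K \<in> carrier_vec (N + 2)"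
    using a by (intro finsum_vec_closed) auto
  have d: "dim_vec (a k) = N + 2" if "k \<in> K" for k using a[OF that] by auto
  have i: "vec_index (finsum_vec TYPE(real) (N + 2) (\<lambda>k. \<alpha> k \<cdot>\<^sub>v a k) K) p = (\<Sum>k\<in>K. \<alpha> k * vec_index (a k) p)"
    if "p < N + 2" for p
    proof -
    have "(\<lambda>k. \<alpha> k \<cdot>\<^sub>v a k) \<in> K \<rightarrow> carrier_vec (N + 2)" using a by auto
    then show ?thesis
      using that d by (simp add: index_finsum_vec[OF assms(2)])
  qed
  define F where "F = finsum_vec TYPE(real) (N + 2) (\<lambda>k. \<alpha> k \<cdot>\<^sub>v a k) K"
  define u where "u = bf N (Some N) - bf N None - F"
  define e where "e p = (if p = N then 1 else if p = N + 1 then -1 else (0::real))" for p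
  have dimF: "dim_vec F = N + 2" using c by (simp add: F_def)
  then have dimu: "dim_vec u = N + 2" by (simp add: u_def bf_def)
  have ui: "vec_index u p = e p - (\<Sum>k\<in>K. \<alpha> k * vec_index (a k) p)" if "p < N + 2" for p
    using that dimF i[OF that, folded F_def] by (simp add: u_def bf_def e_def)
  have "u = 0\<^sub>v (N + 2) \<longleftrightarrow> (\<forall>p<N + 2. vec_index u p = 0)"
  proof
    show "u = 0\<^sub>v (N + 2)" if "\<forall>p<N + 2. vec_index u p = 0"
      using that dimu by (intro eq_vecI) auto
  qed simp
  also have "\<dots> \<longleftrightarrow> (\<forall>p<N + 2. (\<Sum>k\<in>K. \<alpha> k * vec_index (a k) p) = e p)"
    using ui by auto
  finally show ?thesis by (simp only: u_def F_def e_def)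
qed

section \<open>Runs and relaxed runs\<close>

text \<open>
  The conditions on a run that can be read off the Gram matrix and the values. That \<open>x\<^sub>i\<close> minimizes
  over the subspace is weakened to orthogonality of \<open>g\<^sub>i\<close> to the displacements.
\<close>

definition relaxed_run ::
    "('a::euclidean_space \<Rightarrow> ereal) set \<Rightarrow> real \<Rightarrow> nat \<Rightarrow>
     (nat option \<Rightarrow> 'a) \<Rightarrow> (nat option \<Rightarrow> 'a) \<Rightarrow> (nat option \<Rightarrow> real) \<Rightarrow> bool" where
  "relaxed_run \<F> R N x g fv \<longleftrightarrow>
     interpolable \<F> (star_index N) x g fv \<and> g None = 0 \<and>
     (\<forall>i\<in>{1..N}. (\<forall>j<i. inner (g (Some i)) (g (Some j)) = 0) \<and>
                  (\<forall>j\<in>{1..i}. inner (g (Some i)) (x (Some j) - x (Some 0)) = 0)) \<and>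
     norm (x (Some 0) - x None) \<le> R"

lemma subdifferential_imp_finite:
  assumes "proper_fun f" "g \<in> subdifferential f x"
  shows "\<bar>f x\<bar> \<noteq> \<infinity>"
proof -
  obtain y where "f y \<noteq> \<infinity>" using assms(1) by (auto simp: proper_fun_def)
  moreover have "f x + ereal (inner g (y - x)) \<le> f y"
    using assms(2) by (auto simp: subdifferential_def)
  ultimately have "f x \<noteq> \<infinity>" by auto
  then show ?thesis using assms(1) by (auto simp: proper_fun_def)
qed

lemma argmin_on_iff: "x \<in> argmin_on f S \<longleftrightarrow> x \<in> S \<and> (\<forall>y\<in>S. f x \<le> f y)"
  by (auto simp: argmin_on_def is_arg_min_linorder)

lemma zero_subdifferential_iff: "0 \<in> subdifferential f x \<longleftrightarrow> x \<in> argmin_on f UNIV"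
  by (simp add: subdifferential_def argmin_on_iff flip: zero_ereal_def)

lemma min_value_eq: "x \<in> argmin_on f UNIV \<Longrightarrow> min_value f = f x"
  unfolding min_value_def argmin_on_iff by (intro antisym INF_lower INF_greatest) auto

lemma gfom_run_mono: "gfom_run n f x0 x g \<Longrightarrow> m \<le> n \<Longrightarrow> gfom_run m f x0 x g"
  by (auto simp: gfom_run_def)

lemma gfom_run_step_in_span:
  assumes "gfom_run n f x0 x g" "i \<le> n"
  shows "x i - x0 \<in> span (g ` {..<i})"
proof (cases "i = 0")
  case True
  then show ?thesis using assms by (simp add: gfom_run_def span_zero)
next
  case False
  then have "x i \<in> (\<lambda>v. x0 + v) ` span (g ` {..<i})"
    using assms by (auto simp: gfom_run_def argmin_on_iff)
  then show ?thesis by auto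
qed

lemma inner_span_eq_0:
  assumes "v \<in> span S" "\<And>s. s \<in> S \<Longrightarrow> inner u s = 0"
  shows "inner u v = 0"
  using assms(1)
proof (rule span_induct)
  show "subspace {v. inner u v = 0}" by (auto simp: subspace_def inner_add_right)
qed (use assms(2) in auto)

lemma gfom_run_orthogonal:
  assumes "gfom_run n f x0 x g" "j \<le> i" "i \<le> n"
  shows "inner (g i) (x j - x0) = 0"
proof (rule inner_span_eq_0)
  show "x j - x0 \<in> span (g ` {..<j})"
    using gfom_run_step_in_span[OF assms(1)] assms(2,3) by simp
  show "inner (g i) s = 0" if "s \<in> g ` {..<j}" for s
    using that assms by (auto simp: gfom_run_def)
qed

text \<open>
  The subspaces over which the method minimizes increase.
\<close>

lemma gfom_run_decreasing:
  assumes "gfom_run n f x0 x g" "i \<le> j" "j \<le> n"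
  shows "f (x j) \<le> f (x i)"
proof (cases "j = 0")
  case False
  have "x i - x0 \<in> span (g ` {..<j})"
    using gfom_run_step_in_span[OF assms(1), of i] assms(2,3) span_mono[of "g ` {..<i}" "g ` {..<j}"]
    by (auto simp: image_mono)
  then have "x i \<in> (\<lambda>v. x0 + v) ` span (g ` {..<j})"
    by (intro image_eqI[of _ _ "x i - x0"]) auto
  then show ?thesis using False assms by (auto simp: gfom_run_def argmin_on_iff)
qed (use assms in auto)

text \<open>
  The index \<open>*\<close> also gets \<open>z\<close>, so that the same definition serves for the points, with \<open>z\<close> the
  minimizer, and for the subgradients, with \<open>z = 0\<close>.
\<close>

definition truncate_at :: "nat \<Rightarrow> (nat \<Rightarrow> 'a) \<Rightarrow> 'a \<Rightarrow> nat option \<Rightarrow> 'a" where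
  "truncate_at k x z i = (case i of None \<Rightarrow> z | Some j \<Rightarrow> if j < k then x j else z)"

text \<open>
  From index \<open>k\<close> on, the points are the minimizer and the subgradients are \<open>0\<close>. A zero subgradient is
  orthogonal to everything, so the relaxed conditions persist. The case \<open>k = n + 1\<close>, \<open>N = n\<close> is the run
  itself; the smaller \<open>k\<close> supply the Slater point.
\<close>

lemma truncated_run_relaxed:
  assumes run: "gfom_run n f x0 x g" and k: "1 \<le> k" "k \<le> n + 1"
    and f: "f \<in> \<F>" "proper_fun f"
    and xs: "xs \<in> argmin_on f UNIV" "norm (x0 - xs) \<le> R"
  shows "relaxed_run \<F> R N (truncate_at k x xs) (truncate_at k g 0) (\<lambda>i. real_of_ereal (f (truncate_at k x xs i)))"
proof -
  have sub: "truncate_at k g 0 i \<in> subdifferential f (truncate_at k x xs i)" for i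
    using run k xs(1) by (auto simp: truncate_at_def gfom_run_def zero_subdifferential_iff split: option.splits)
  then have "f (truncate_at k x xs i) = ereal (real_of_ereal (f (truncate_at k x xs i)))" for i
    using subdifferential_imp_finite[OF f(2) sub] by (simp add: ereal_real')
  then have "interpolable \<F> (star_index N) (truncate_at k x xs) (truncate_at k g 0)
      (\<lambda>i. real_of_ereal (f (truncate_at k x xs i)))"
    using f(1) sub unfolding interpolable_def by blast
  moreover have "truncate_at k x xs (Some 0) = x0" using run k by (simp add: truncate_at_def gfom_run_def)
  moreover have "inner (g i) (g j) = 0" if "j < i" "i < k" for i j
    using run that k by (auto simp: gfom_run_def)
  ultimately show ?thesis
    using xs(2) gfom_run_orthogonal[OF run] k by (auto simp: relaxed_run_def truncate_at_def)
qed

text \<open>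
  Add up the interpolation inequalities with weights \<open>\<alpha> k\<close>. The equality constraint of \<open>(D)\<close> isolates
  \<open>f\<^sub>N - f\<^sub>*\<close>, and the matrix terms are at least \<open>- \<tau> R\<^sup>2\<close>, since the dual matrix pairs
  nonnegatively with the Gram matrix, in which the entries met by \<open>\<beta>\<close> and \<open>\<gamma>\<close> are zero.
\<close>

lemma relaxed_run_weak_duality:
  assumes enc: "encodes_interpolation N \<F> K A a b" and rel: "relaxed_run \<F> R N x g fv"
    and dual: "dual_feasible N K A a \<alpha> \<beta> \<gamma> \<tau>"
  shows "fv (Some N) - fv None \<le> \<tau> * R\<^sup>2 - (\<Sum>k\<in>K. \<alpha> k * b k)"
proof -
  define H where "H p q = inner (P_col N x g p) (P_col N x g q)" for p q
  define v where "v p = (if p \<le> N then fv (Some p) else fv None)" for p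
  have K: "finite K" and A: "\<And>k. k \<in> K \<Longrightarrow> A k \<in> carrier_mat (2 * N + 2) (2 * N + 2)"
    and a: "\<And>k. k \<in> K \<Longrightarrow> a k \<in> carrier_vec (N + 2)"
    using enc by (auto simp: encodes_interpolation_def)
  have H: "H p q = H q p" for p q by (simp add: H_def inner_commute)
  have cons: "mat_form (A k) H + (\<Sum>p<N + 2. vec_index (a k) p * v p) + b k \<le> 0" if "k \<in> K" for k
  proof -
    have "mat_trace (A k * gram_mat N x g) + scalar_prod (a k) (value_vec N fv) + b k \<le> 0"
      using enc rel that unfolding encodes_interpolation_def relaxed_run_def by blast
    then show ?thesis
      by (simp only: mat_trace_times_gram[OF A[OF that]] scalar_prod_value_vec H_def[abs_def] v_def)
  qed
  have \<alpha>: "\<forall>k\<in>K. \<alpha> k \<ge> 0" and \<tau>: "\<tau> \<ge> 0" and psd: "psd (dual_matrix N K A \<alpha> \<beta> \<gamma> \<tau>)"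
    and eq: "\<forall>p<N + 2. (\<Sum>k\<in>K. \<alpha> k * vec_index (a k) p) = (if p = N then 1 else if p = N + 1 then -1 else 0)"
    using dual dual_equation_iff[OF a K] by (auto simp: dual_feasible_def)
  have z1: "H i j = 0" if "i \<in> {1..N}" "j < i" for i j
    using rel that by (auto simp: relaxed_run_def H_def P_col_def)
  have z2: "H i (N + j) = 0" if "i \<in> {1..N}" "j \<in> {1..i}" for i j
    using rel that by (auto simp: relaxed_run_def H_def P_col_def)
  have "0 \<le> mat_form (dual_matrix N K A \<alpha> \<beta> \<gamma> \<tau>) H"
    unfolding H_def[abs_def] by (rule mat_form_gram_nonneg[OF dual_matrix_carrier psd])
  also have "\<dots> = (\<Sum>k\<in>K. \<alpha> k * mat_form (A k) H) + \<tau> * H (2 * N + 1) (2 * N + 1)"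
    using z1 z2 by (simp add: mat_form_dual_matrix[where H = H, OF A H])
  also have "H (2 * N + 1) (2 * N + 1) = (norm (x (Some 0) - x None))\<^sup>2"
    by (simp add: H_def P_col_def power2_norm_eq_inner inner_commute inner_diff algebra_simps)
  also have "\<tau> * (norm (x (Some 0) - x None))\<^sup>2 \<le> \<tau> * R\<^sup>2"
    using rel \<tau> by (intro mult_left_mono power_mono) (auto simp: relaxed_run_def)
  finally have 1: "0 \<le> (\<Sum>k\<in>K. \<alpha> k * mat_form (A k) H) + \<tau> * R\<^sup>2" by simp
  have "(\<Sum>k\<in>K. \<alpha> k * (\<Sum>p<N + 2. vec_index (a k) p * v p))
      = (\<Sum>k\<in>K. \<Sum>p<N + 2. \<alpha> k * vec_index (a k) p * v p)"
    by (simp only: sum_distrib_left mult.assoc)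
  also have "\<dots> = (\<Sum>p<N + 2. \<Sum>k\<in>K. \<alpha> k * vec_index (a k) p * v p)"
    by (rule sum.swap)
  also have "\<dots> = (\<Sum>p<N + 2. (if p = N then 1 else if p = N + 1 then -1 else 0) * v p)"
    using eq by (intro sum.cong refl) (simp flip: sum_distrib_right)
  also have "\<dots> = v N - v (N + 1)" by simp
  finally have 2: "(\<Sum>k\<in>K. \<alpha> k * (\<Sum>p<N + 2. vec_index (a k) p * v p)) = v N - v (N + 1)" .
  have "(\<Sum>k\<in>K. \<alpha> k * (mat_form (A k) H + (\<Sum>p<N + 2. vec_index (a k) p * v p) + b k)) \<le> 0"
    using \<alpha> cons by (intro sum_nonpos) (simp add: mult_nonneg_nonpos)
  then have "(\<Sum>k\<in>K. \<alpha> k * mat_form (A k) H) + (v N - v (N + 1)) + (\<Sum>k\<in>K. \<alpha> k * b k) \<le> 0"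
    by (simp only: 2[symmetric] distrib_left sum.distrib)
  with 1 show ?thesis by (simp add: v_def)
qed

lemma inner_orthogonal_sum:
  fixes g :: "nat \<Rightarrow> 'a::real_inner"
  assumes "finite J" "j \<in> J" "\<And>i. i \<in> J \<Longrightarrow> i \<noteq> j \<Longrightarrow> inner (g i) (g j) = 0"
  shows "inner (\<Sum>i\<in>J. c i *\<^sub>R g i) (g j) = c j * inner (g j) (g j)"
proof -
  have "inner (\<Sum>i\<in>J. c i *\<^sub>R g i) (g j) = (\<Sum>i\<in>J. if i = j then c i * inner (g j) (g j) else 0)"
    unfolding inner_sum_left using assms(3) by (intro sum.cong refl) auto
  then show ?thesis using assms by simp
qed

text \<open>
  Let \<open>\<pi>\<close> be the orthogonal projection onto the span of the mutually orthogonal \<open>g\<^sub>0, \<dots>, g\<^sub>N\<close>.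
  Replacing \<open>x\<^sub>i - x\<^sub>0\<close> by its projection is a contraction that keeps all inner products with
  subgradients, so a function \<open>f\<close> of the class still interpolates. Since \<open>x\<^sub>i - x\<^sub>0\<close> is orthogonal to
  \<open>g\<^sub>i, \<dots>, g\<^sub>N\<close>, its projection lies in the span of \<open>g\<^sub>0, \<dots>, g\<^sub>i\<^sub>-\<^sub>1\<close>, and there the new point
  minimizes \<open>f\<close> because \<open>g\<^sub>i\<close> is orthogonal to that span.
\<close>

lemma relaxed_run_realizable:
  assumes rel: "relaxed_run \<F> R N x g fv" and cp: "contraction_preserving \<F>" and N: "N \<ge> 1"
  shows "\<exists>f x0 y. is_input \<F> R f x0 \<and> gfom_output N f x0 y \<and>
           f y - min_value f = ereal (fv (Some N) - fv None)"
proof -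
  define h where "h j = g (Some j)" for j
  \<comment> \<open>summands with \<open>h j = 0\<close> vanish, the quotient then being \<open>0\<close>\<close>
  define \<pi> where "\<pi> u = (\<Sum>j\<le>N. (inner u (h j) / inner (h j) (h j)) *\<^sub>R h j)" for u
  have orth: "inner (h i) (h j) = 0" if "i \<noteq> j" "i \<le> N" "j \<le> N" for i j
  proof (cases "j < i")
    case True
    then show ?thesis using rel that by (auto simp: relaxed_run_def h_def)
  next
    case False
    then have "inner (h j) (h i) = 0" using rel that by (auto simp: relaxed_run_def h_def)
    then show ?thesis by (simp add: inner_commute)
  qed
  have inner_\<pi>: "inner (\<pi> u) (h j) = inner u (h j)" if "j \<le> N" for u j
    unfolding \<pi>_def using that orth by (subst inner_orthogonal_sum) auto
  have \<pi>_diff: "\<pi> (u - w) = \<pi> u - \<pi> w" for u w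
    unfolding \<pi>_def by (simp add: inner_diff_left diff_divide_distrib scaleR_diff_left sum_subtractf)
  have norm_\<pi>: "norm (\<pi> u) \<le> norm u" for u
  proof -
    have "inner (u - \<pi> u) (\<pi> u) = 0"
      by (subst (2) \<pi>_def) (simp add: inner_sum_right inner_diff_left inner_\<pi>)
    then have "(norm u)\<^sup>2 = (norm (u - \<pi> u))\<^sup>2 + (norm (\<pi> u))\<^sup>2"
      unfolding power2_norm_eq_inner by (simp add: inner_diff inner_commute)
    then show ?thesis using power2_le_imp_le[of "norm (\<pi> u)" "norm u"] by simp
  qed
  define y where "y i = x (Some 0) + \<pi> (x i - x (Some 0))" for i
  have y_diff: "y i - y j = \<pi> (x i - x j)" for i j
    using \<pi>_diff[of "x i - x (Some 0)" "x j - x (Some 0)"] by (simp add: y_def)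
  have y0: "y (Some 0) = x (Some 0)" by (simp add: y_def \<pi>_def)
  have int: "interpolable \<F> (star_index N) y g fv"
  proof -
    \<comment> \<open>relabels \<open>0, \<dots>, N + 1\<close> as \<open>*, 0, \<dots>, N\<close>\<close>
    define r where "r n = (case n of 0 \<Rightarrow> None | Suc j \<Rightarrow> Some j)" for n :: nat
    have "star_index N = r ` {..N + 1}"
      by (force simp: star_index_def r_def image_iff split: nat.splits)
    then have tr: "interpolable \<F> (star_index N) z g fv \<longleftrightarrow>
        interpolable \<F> {..N + 1} (z \<circ> r) (g \<circ> r) (fv \<circ> r)" for z
      by (simp add: interpolable_def)
    have "inner (g j) (y i - y k) = inner (g j) (x i - x k)" if "j \<in> star_index N" for i j k
      using that rel inner_\<pi>[of _ "x i - x k"]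
      by (auto simp: y_diff star_index_def relaxed_run_def h_def inner_commute)
    moreover have "norm (y i - y k) \<le> norm (x i - x k)" for i k
      unfolding y_diff by (rule norm_\<pi>)
    moreover have "r i \<in> star_index N" if "i \<le> N + 1" for i
      using that by (auto simp: r_def star_index_def split: nat.splits)
    moreover have "interpolable \<F> {..N + 1} (x \<circ> r) (g \<circ> r) (fv \<circ> r)"
      using rel tr by (simp add: relaxed_run_def)
    ultimately have "interpolable \<F> {..N + 1} (y \<circ> r) (g \<circ> r) (fv \<circ> r)"
      using cp[unfolded contraction_preserving_def, rule_format,
          of "{..N + 1}" "x \<circ> r" "g \<circ> r" "fv \<circ> r" "y \<circ> r"] by auto
    then show ?thesis using tr by blast
  qed
  then obtain f where f: "f \<in> \<F>" "\<And>i. i \<in> star_index N \<Longrightarrow> g i \<in> subdifferential f (y i) \<and> f (y i) = ereal (fv i)"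
    by (auto simp: interpolable_def)
  have I: "None \<in> star_index N" "\<And>i. i \<le> N \<Longrightarrow> Some i \<in> star_index N"
    by (auto simp: star_index_def)
  have min: "y None \<in> argmin_on f UNIV"
    using f(2)[OF I(1)] rel by (simp add: relaxed_run_def flip: zero_subdifferential_iff)
  have "norm (y (Some 0) - y None) \<le> R"
    using norm_\<pi>[of "x (Some 0) - x None"] rel by (simp add: y_diff relaxed_run_def)
  then have input: "is_input \<F> R f (y (Some 0))" using f(1) min by (auto simp: is_input_def)
  have span: "y (Some i) - y (Some 0) \<in> span (h ` {..<i})" if "i \<le> N" for i
  proof -
    have "\<pi> (x (Some i) - x (Some 0)) = (\<Sum>j<i. (inner (x (Some i) - x (Some 0)) (h j) / inner (h j) (h j)) *\<^sub>R h j)"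
      unfolding \<pi>_def
    proof (rule sum.mono_neutral_right)
      show "\<forall>j\<in>{..N} - {..<i}. (inner (x (Some i) - x (Some 0)) (h j) / inner (h j) (h j)) *\<^sub>R h j = 0"
      proof
        fix j assume j: "j \<in> {..N} - {..<i}"
        have "inner (h j) (x (Some i) - x (Some 0)) = 0"
          using rel j by (cases "i = 0") (auto simp: relaxed_run_def h_def)
        then show "(inner (x (Some i) - x (Some 0)) (h j) / inner (h j) (h j)) *\<^sub>R h j = 0"
          by (simp add: inner_commute)
      qed
    qed (use that in auto)
    also have "\<dots> \<in> span (h ` {..<i})"
      by (intro span_sum span_scale span_base) auto
    finally show ?thesis by (simp add: y_def \<pi>_def)
  qed
  have "gfom_run N f (y (Some 0)) (\<lambda>i. y (Some i)) h"
    unfolding gfom_run_def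
  proof (intro conjI allI impI ballI)
    show "h i \<in> subdifferential f (y (Some i))" if "i \<le> N" for i
      using f(2)[OF I(2)[OF that]] by (simp add: h_def)
    show "inner (h i) (h j) = 0" if "i \<in> {1..N}" "j < i" for i j
      using orth that by auto
    show "y (Some i) \<in> argmin_on f ((+) (y (Some 0)) ` span (h ` {..<i}))" if i: "i \<in> {1..N}" for i
      unfolding argmin_on_iff
    proof (intro conjI ballI)
      show "y (Some i) \<in> (+) (y (Some 0)) ` span (h ` {..<i})"
        using span[of i] i by (intro image_eqI[of _ _ "y (Some i) - y (Some 0)"]) auto
      fix z assume "z \<in> (+) (y (Some 0)) ` span (h ` {..<i})"
      then have "z - y (Some 0) \<in> span (h ` {..<i})" by auto
      then have "z - y (Some i) \<in> span (h ` {..<i})"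
        using span_diff[OF _ span[of i], of "z - y (Some 0)"] i by simp
      then have "inner (h i) (z - y (Some i)) = 0"
        using orth i by (elim inner_span_eq_0) auto
      moreover have "f (y (Some i)) + ereal (inner (h i) (z - y (Some i))) \<le> f z"
        using f(2)[OF I(2), of i] i by (auto simp: subdifferential_def h_def)
      ultimately show "f (y (Some i)) \<le> f z" by (simp flip: zero_ereal_def)
    qed
  qed simp
  then have "gfom_output N f (y (Some 0)) (y (Some N))" by (auto simp: gfom_output_def)
  moreover have "f (y (Some N)) - min_value f = ereal (fv (Some N) - fv None)"
    using f(2)[OF I(1)] f(2)[OF I(2)[OF order_refl]] min_value_eq[OF min] by simp
  ultimately show ?thesis using input by blast
qed

section \<open>The cone of Gram matrices\<close>

definition gram :: "('n::finite \<Rightarrow> 'a::real_inner) \<Rightarrow> real ^ 'n ^ 'n" where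
  "gram P = (\<chi> r s. inner (P r) (P s))"

text \<open>
  Only the indices in \<open>S\<close> carry vectors. This represents configurations of \<open>2N + 2\<close> vectors by a
  matrix type whose size may be larger. The second component, for the function values, is free.
\<close>

definition gram_cone :: "'n::finite set \<Rightarrow> ((real ^ 'n ^ 'n) \<times> 'h) set" where
  "gram_cone S = {(gram P, F) | (P :: 'n \<Rightarrow> real ^ 'n) F. \<forall>r. r \<notin> S \<longrightarrow> P r = 0}"

lemma gram_coneI:
  fixes P :: "'n::finite \<Rightarrow> real ^ 'n"
  shows "(\<And>r. r \<notin> S \<Longrightarrow> P r = 0) \<Longrightarrow> (gram P, F) \<in> gram_cone S"
  unfolding gram_cone_def by blast

text \<open>
  The vectors \<open>(P r, Q r)\<close> of the product space have the required inner products. As there are at most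
  \<open>n\<close> of them, their span embeds isometrically into \<open>\<real>\<^sup>n\<close>. This is where the dimension has to be
  at least the number of vectors.
\<close>

lemma gram_sum_realizable:
  fixes P Q :: "'n::finite \<Rightarrow> real ^ 'n"
  assumes "\<forall>r. r \<notin> S \<longrightarrow> P r = 0" "\<forall>r. r \<notin> S \<longrightarrow> Q r = 0"
  shows "\<exists>P' :: 'n \<Rightarrow> real ^ 'n. (\<forall>r. r \<notin> S \<longrightarrow> P' r = 0) \<and> gram P' = gram P + gram Q"
proof -
  define z where "z r = (P r, Q r)" for r
  have "dim (span (range z)) \<le> card (range z)"
    using dim_le_card'[of "range z"] by simp
  also have "\<dots> \<le> CARD('n)" by (rule card_image_le) simp
  finally have d: "dim (span (range z)) \<le> dim (UNIV :: (real ^ 'n) set)" by simp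
  obtain h :: "(real ^ 'n) \<times> (real ^ 'n) \<Rightarrow> real ^ 'n"
    where h: "linear h" "h \<in> span (range z) \<rightarrow> UNIV"
      "\<And>w. w \<in> span (range z) \<Longrightarrow> norm (h w) = norm w"
    by (rule isometry_subset_subspace[OF subspace_span subspace_UNIV d]) (rule that)
  have hh: "inner (h v) (h w) = inner v w" if "v \<in> span (range z)" "w \<in> span (range z)" for v w
  proof -
    have "(norm (h (v + w)))\<^sup>2 = (norm (v + w))\<^sup>2" "(norm (h v))\<^sup>2 = (norm v)\<^sup>2" "(norm (h w))\<^sup>2 = (norm w)\<^sup>2"
      using h(3)[OF span_add[OF that]] h(3)[OF that(1)] h(3)[OF that(2)] by simp_all
    then show ?thesis
      unfolding power2_norm_eq_inner linear_add[OF h(1)]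
      by (simp add: inner_add inner_commute)
  qed
  have "inner (h (z r)) (h (z s)) = inner (P r) (P s) + inner (Q r) (Q s)" for r s
    by (simp add: hh span_base) (simp add: z_def)
  then have "gram (\<lambda>r. h (z r)) = gram P + gram Q"
    by (simp add: gram_def Finite_Cartesian_Product.vec_eq_iff)
  moreover have "h (z r) = 0" if "r \<notin> S" for r
    using assms that linear_0[OF h(1)] by (simp add: z_def flip: zero_prod_def)
  ultimately show ?thesis by (intro exI[of _ "\<lambda>r. h (z r)"]) simp
qed

lemma gram_cone_add:
  assumes "p \<in> gram_cone S" "q \<in> (gram_cone S :: ((real ^ 'n ^ 'n) \<times> 'h::real_vector) set)"
  shows "p + q \<in> gram_cone S"
proof -
  obtain P F Q F' where p: "p = (gram P, F)" and P: "\<forall>r. r \<notin> S \<longrightarrow> P r = (0 :: real ^ 'n)"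
    and q: "q = (gram Q, F')" and Q: "\<forall>r. r \<notin> S \<longrightarrow> Q r = (0 :: real ^ 'n)"
    using assms by (auto simp: gram_cone_def)
  obtain P' :: "'n \<Rightarrow> real ^ 'n" where "\<forall>r. r \<notin> S \<longrightarrow> P' r = 0" "gram P' = gram P + gram Q"
    using gram_sum_realizable[OF P Q] by blast
  moreover from this have "p + q = (gram P', F + F')" by (simp add: p q)
  ultimately show ?thesis unfolding gram_cone_def by blast
qed

lemma gram_cone_scale:
  assumes "p \<in> (gram_cone S :: ((real ^ 'n ^ 'n) \<times> 'h::real_vector) set)" "t \<ge> 0"
  shows "t *\<^sub>R p \<in> gram_cone S"
proof -
  obtain P F where p: "p = (gram P, F)" and P: "\<forall>r. r \<notin> S \<longrightarrow> P r = (0 :: real ^ 'n)"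
    using assms by (auto simp: gram_cone_def)
  have "gram (\<lambda>r. sqrt t *\<^sub>R P r) = t *\<^sub>R gram P"
    using assms(2) by (simp add: gram_def Finite_Cartesian_Product.vec_eq_iff flip: mult.assoc)
  then have "t *\<^sub>R p = (gram (\<lambda>r. sqrt t *\<^sub>R P r), t *\<^sub>R F)" by (simp add: p)
  then show ?thesis using P unfolding gram_cone_def by fastforce
qed

definition vec_outer :: "real ^ 'n \<Rightarrow> real ^ 'n \<Rightarrow> real ^ 'n ^ 'n" where
  "vec_outer u v = (\<chi> r s. vec_nth u r * vec_nth v s)"

lemma vec_outer_add:
  "vec_outer (u + u') v = vec_outer u v + vec_outer u' v"
  "vec_outer v (u + u') = vec_outer v u + vec_outer v u'"
  by (simp_all add: vec_outer_def Finite_Cartesian_Product.vec_eq_iff algebra_simps)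

lemma vec_outer_scale:
  "vec_outer (s *\<^sub>R u) v = s *\<^sub>R vec_outer u v"
  "vec_outer v (s *\<^sub>R u) = s *\<^sub>R vec_outer v u"
  by (simp_all add: vec_outer_def Finite_Cartesian_Product.vec_eq_iff algebra_simps)

lemma gram_eq_sum_outer:
  fixes P :: "'n::finite \<Rightarrow> 'a::euclidean_space"
  shows "gram P = (\<Sum>e\<in>Basis. vec_outer (\<chi> r. inner (P r) e) (\<chi> r. inner (P r) e))"
  unfolding Finite_Cartesian_Product.vec_eq_iff gram_def vec_outer_def
  by (subst euclidean_inner) (simp add: sum_component)

text \<open>
  This provides Slater's condition. A functional \<open>m\<close> that is nonnegative on the cone does not see the
  free component and is given by a positive semidefinite form \<open>B\<close> on the vectors supported on \<open>S\<close>.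
  If \<open>m\<close> is not positive at a positive combination of the points \<open>(gram (Q t), F t)\<close>, all coordinate
  rows of the \<open>Q t\<close> are isotropic for \<open>B\<close>, hence in its radical \<open>Z\<close>. A vector orthogonal to \<open>Z\<close> is a
  linear relation that holds in every \<open>Q t\<close>, so by nondegeneracy the radical is everything.
\<close>

lemma gram_cone_dual_vanishes:
  fixes Q :: "'t \<Rightarrow> 'n::finite \<Rightarrow> real ^ 'n" and m :: "(real ^ 'n ^ 'n) \<times> 'h::euclidean_space"
  assumes T: "finite T" "\<And>t. t \<in> T \<Longrightarrow> c t > 0" "\<And>t r. t \<in> T \<Longrightarrow> r \<notin> S \<Longrightarrow> Q t r = 0"
    and nondeg: "\<And>u. (\<forall>r. r \<notin> S \<longrightarrow> vec_nth u r = 0) \<Longrightarrow>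
        (\<forall>t\<in>T. (\<Sum>r\<in>UNIV. vec_nth u r *\<^sub>R Q t r) = 0) \<Longrightarrow> u = 0"
    and m: "\<forall>y\<in>gram_cone S. inner m y \<ge> 0" "inner m (\<Sum>t\<in>T. c t *\<^sub>R (gram (Q t), F t)) \<le> 0"
    and x: "x \<in> gram_cone S"
  shows "inner m x = 0"
proof -
  define M where "M = fst m"
  define B where "B u v = inner M (vec_outer u v)" for u v
  define V where "V = {u :: real ^ 'n. \<forall>r. r \<notin> S \<longrightarrow> vec_nth u r = 0}"
  define row where "row P e = (\<chi> r. inner (P r) e)" for P :: "'n \<Rightarrow> real ^ 'n" and e
  have "(gram (\<lambda>r. 0 :: real ^ 'n), - snd m) \<in> gram_cone S" unfolding gram_cone_def by blast
  with m(1) have "inner m (gram (\<lambda>r. 0 :: real ^ 'n), - snd m) \<ge> 0" by blast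
  moreover have "gram (\<lambda>r :: 'n. 0 :: real ^ 'n) = 0" by (simp add: gram_def Finite_Cartesian_Product.vec_eq_iff)
  ultimately have "inner (snd m) (snd m) \<le> 0" by (simp add: inner_prod_def)
  then have "snd m = 0" using inner_gt_zero_iff[of "snd m"] by linarith
  then have inner_m: "inner m y = inner M (fst y)" for y by (simp add: inner_prod_def M_def)
  have V: "subspace V" by (auto simp: V_def subspace_def)
  have B_add: "B (u + u') v = B u v + B u' v" "B v (u + u') = B v u + B v u'" for u u' v
    by (simp_all add: B_def vec_outer_add inner_add_right)
  have B_scale: "B (s *\<^sub>R u) v = s * B u v" "B v (s *\<^sub>R u) = s * B v u" for s u v
    by (simp_all add: B_def vec_outer_scale)
  have B_nonneg: "B u u \<ge> 0" if "u \<in> V" for u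
  proof -
    obtain e :: "real ^ 'n" where e: "e \<in> Basis" using nonempty_Basis by blast
    have "vec_outer u u = gram (\<lambda>r. vec_nth u r *\<^sub>R e)"
      using e by (simp add: vec_outer_def gram_def Finite_Cartesian_Product.vec_eq_iff inner_Basis)
    moreover have "(gram (\<lambda>r. vec_nth u r *\<^sub>R e), 0) \<in> gram_cone S"
      using that unfolding gram_cone_def V_def by fastforce
    ultimately show ?thesis using m(1) inner_m unfolding B_def by fastforce
  qed
  have gram_rows: "inner M (gram P) = (\<Sum>e\<in>Basis. B (row P e) (row P e))" for P
    by (simp add: gram_eq_sum_outer inner_sum_right B_def row_def)
  have row_V: "row P e \<in> V" if "\<forall>r. r \<notin> S \<longrightarrow> P r = 0" for P :: "'n \<Rightarrow> real ^ 'n" and e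
    using that by (simp add: row_def V_def)
  have gram_nonneg: "inner M (gram P) \<ge> 0" if "\<forall>r. r \<notin> S \<longrightarrow> P r = 0" for P :: "'n \<Rightarrow> real ^ 'n"
    unfolding gram_rows using B_nonneg row_V[OF that] by (intro sum_nonneg) auto
  define Z where "Z = {u \<in> V. B u u = 0}"
  have radical: "B u v + B v u = 0" if "u \<in> Z" "v \<in> V" for u v
  proof (rule ccontr)
    assume ne: "B u v + B v u \<noteq> 0"
    define t where "t = (- B v v - 1) / (B u v + B v u)"
    have "v + t *\<^sub>R u \<in> V" using that V by (auto simp: Z_def intro: subspace_add subspace_scale)
    then have "0 \<le> B (v + t *\<^sub>R u) (v + t *\<^sub>R u)" by (rule B_nonneg)
    also have "\<dots> = B v v + t * (B u v + B v u)"
      using that by (simp add: B_add B_scale Z_def algebra_simps)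
    also have "\<dots> = -1" using ne by (simp add: t_def)
    finally show False by simp
  qed
  have Z: "subspace Z"
  proof (unfold subspace_def, intro conjI ballI allI)
    show "0 \<in> Z" using B_scale(1)[of 0 0 0] V by (simp add: Z_def subspace_0)
    show "u + v \<in> Z" if "u \<in> Z" "v \<in> Z" for u v
      using radical[of u v] that V by (simp add: Z_def B_add subspace_add)
    show "s *\<^sub>R u \<in> Z" if "u \<in> Z" for s u
      using that V by (simp add: Z_def B_scale subspace_scale)
  qed
  have "inner M (gram (Q t)) = 0" if "t \<in> T" for t
  proof -
    have nn: "c t * inner M (gram (Q t)) \<ge> 0" if "t \<in> T" for t
      using gram_nonneg[of "Q t"] T that by (simp add: less_imp_le)
    have "(\<Sum>t\<in>T. c t * inner M (gram (Q t))) \<le> 0"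
      using m(2) by (simp add: inner_m fst_sum inner_sum_right)
    moreover have "(\<Sum>t\<in>T. c t * inner M (gram (Q t))) \<ge> 0"
      by (rule sum_nonneg) (rule nn)
    ultimately have "(\<Sum>t\<in>T. c t * inner M (gram (Q t))) = 0" by simp
    then have "c t * inner M (gram (Q t)) = 0"
      using sum_nonneg_eq_0_iff[OF T(1), of "\<lambda>t. c t * inner M (gram (Q t))"] nn that by blast
    then show ?thesis using T(2)[OF that] by simp
  qed
  then have rowZ: "row (Q t) e \<in> Z" if "t \<in> T" "e \<in> Basis" for t e
    using that T(3) row_V[of "Q t"] B_nonneg sum_nonneg_eq_0_iff[of Basis "\<lambda>e. B (row (Q t) e) (row (Q t) e)"]
    by (simp add: Z_def gram_rows)
  have "Z = V"
  proof (rule ccontr)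
    assume "Z \<noteq> V"
    moreover have "Z \<subseteq> V" by (auto simp: Z_def)
    moreover have "span Z = Z" "span V = V" using Z V by (simp_all only: span_eq_iff)
    ultimately have "span Z \<subset> span V" by blast
    then obtain u where u: "u \<noteq> 0" "u \<in> span V" "\<And>y. y \<in> span Z \<Longrightarrow> Linear_Algebra.orthogonal u y"
      using orthogonal_to_subspace_exists_gen by blast
    have "(\<Sum>r\<in>UNIV. vec_nth u r *\<^sub>R Q t r) = 0" if "t \<in> T" for t
    proof (rule euclidean_eqI)
      fix e :: "real ^ 'n" assume "e \<in> Basis"
      then have "inner u (row (Q t) e) = 0"
        using u(3) span_base[OF rowZ[OF that]] by (simp add: Linear_Algebra.orthogonal_def)
      moreover have "inner u (row (Q t) e) = (\<Sum>r\<in>UNIV. vec_nth u r * inner (Q t r) e)"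
        by (simp add: inner_vec_def[of u] row_def)
      ultimately show "inner (\<Sum>r\<in>UNIV. vec_nth u r *\<^sub>R Q t r) e = inner 0 e"
        by (simp add: inner_sum_left)
    qed
    moreover have "u \<in> V" using u(2) V by (simp add: span_eq_iff[THEN iffD2])
    ultimately have "u = 0" using nondeg by (simp add: V_def)
    with u(1) show False by simp
  qed
  moreover obtain P G where "x = (gram P, G)" "\<forall>r. r \<notin> S \<longrightarrow> P r = (0 :: real ^ 'n)"
    using x by (auto simp: gram_cone_def)
  ultimately show ?thesis
    using row_V[of P] by (auto simp: inner_m gram_rows Z_def intro!: sum.neutral)
qed

section \<open>Absence of a duality gap\<close>

text \<open>
  A pair \<open>(i, q)\<close> stands for the equation \<open>\<langle>g\<^sub>i, P\<^sub>q\<rangle> = 0\<close>, where the column \<open>P\<^sub>q\<close> of \<open>P\<close> is \<open>g\<^sub>q\<close> for \<open>q < i\<close>,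
  with multiplier \<open>\<beta> i q\<close> in \<open>(D)\<close>, or \<open>x\<^sub>j - x\<^sub>0\<close> for \<open>q = N + j\<close>, with multiplier \<open>\<gamma> i j\<close>.
\<close>

lemma sum_equality_multipliers:
  fixes \<mu> H :: "nat \<Rightarrow> nat \<Rightarrow> real"
  shows "(\<Sum>(i, q)\<in>Sigma {1..N} (\<lambda>i. {..<i} \<union> (+) N ` {1..i}). \<mu> i q * H i q)
    = (\<Sum>i=1..N. (\<Sum>j<i. \<mu> i j * H i j) + (\<Sum>j=1..i. \<mu> i (N + j) * H i (N + j)))"
proof -
  have "(\<Sum>(i, q)\<in>Sigma {1..N} (\<lambda>i. {..<i} \<union> (+) N ` {1..i}). \<mu> i q * H i q)
      = (\<Sum>i\<in>{1..N}. \<Sum>q\<in>{..<i} \<union> (+) N ` {1..i}. \<mu> i q * H i q)"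
    by (rule sum.Sigma[symmetric]) auto
  also have "\<dots> = (\<Sum>i=1..N. (\<Sum>j<i. \<mu> i j * H i j) + (\<Sum>j=1..i. \<mu> i (N + j) * H i (N + j)))"
  proof (intro sum.cong refl)
    fix i assume i: "i \<in> {1..N}"
    then have "{..<i} \<inter> (+) N ` {1..i} = {}" by auto
    then have "(\<Sum>q\<in>{..<i} \<union> (+) N ` {1..i}. \<mu> i q * H i q)
        = (\<Sum>q\<in>{..<i}. \<mu> i q * H i q) + (\<Sum>q\<in>(+) N ` {1..i}. \<mu> i q * H i q)"
      by (intro sum.union_disjoint) auto
    then show "(\<Sum>q\<in>{..<i} \<union> (+) N ` {1..i}. \<mu> i q * H i q)
        = (\<Sum>j<i. \<mu> i j * H i j) + (\<Sum>j=1..i. \<mu> i (N + j) * H i (N + j))"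
      by (simp only: sum.reindex[OF inj_on_add] o_def)
  qed
  finally show ?thesis .
qed

lemma affine_nonneg_imp_zero:
  fixes s c :: real
  assumes "\<And>t. 0 \<le> t * s + c"
  shows "s = 0"
proof (rule ccontr)
  assume "s \<noteq> 0"
  then show False using assms[of "(- c - 1) / s"] by simp
qed

lemma quadratic_nonneg_imp_nonneg:
  fixes s c :: real
  assumes "\<And>t. 0 \<le> t\<^sup>2 * s + c"
  shows "0 \<le> s"
proof (rule ccontr)
  assume s: "\<not> 0 \<le> s"
  have "c \<ge> 0" using assms[of 0] by simp
  then have "(sqrt ((c + 1) / (- s)))\<^sup>2 = (c + 1) / (- s)"
    using s by (intro real_sqrt_pow2) (simp add: divide_nonneg_neg)
  with assms[of "sqrt ((c + 1) / (- s))"] s show False by (simp add: field_simps)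
qed

text \<open>
  Relaxed runs as the feasible set of a semidefinite program in the Gram matrix \<open>H\<close> and the values.
\<close>

lemma relaxed_run_iff:
  fixes x g :: "nat option \<Rightarrow> 'a::euclidean_space"
  assumes enc: "encodes_interpolation N \<F> K A a b" and R: "R \<ge> 0" and g: "g None = 0"
  defines "H \<equiv> \<lambda>p q. inner (P_col N x g p) (P_col N x g q)"
  shows "relaxed_run \<F> R N x g fv \<longleftrightarrow>
     (\<forall>k\<in>K. mat_form (A k) H + (\<Sum>p<N + 2. vec_index (a k) p * (if p \<le> N then fv (Some p) else fv None)) + b k \<le> 0) \<and>
     (\<forall>(i, q)\<in>Sigma {1..N} (\<lambda>i. {..<i} \<union> (+) N ` {1..i}). H i q = 0) \<and>
     H (2 * N + 1) (2 * N + 1) \<le> R\<^sup>2"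
proof -
  have A: "A k \<in> carrier_mat (2 * N + 2) (2 * N + 2)" if "k \<in> K" for k
    using enc that by (auto simp: encodes_interpolation_def)
  have 1: "interpolable \<F> (star_index N) x g fv \<longleftrightarrow>
      (\<forall>k\<in>K. mat_form (A k) H + (\<Sum>p<N + 2. vec_index (a k) p * (if p \<le> N then fv (Some p) else fv None)) + b k \<le> 0)"
    using enc g unfolding encodes_interpolation_def H_def
    by (simp only: mat_trace_times_gram[OF A] scalar_prod_value_vec cong: ball_cong)
  have "(\<forall>(i, q)\<in>Sigma {1..N} (\<lambda>i. {..<i} \<union> (+) N ` {1..i}). H i q = 0) \<longleftrightarrow>
      (\<forall>i\<in>{1..N}. \<forall>q\<in>{..<i} \<union> (+) N ` {1..i}. H i q = 0)"
    by blast
  also have "\<dots> \<longleftrightarrow> (\<forall>i\<in>{1..N}. (\<forall>j<i. H i j = 0) \<and> (\<forall>l\<in>{1..i}. H i (N + l) = 0))"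
    by (simp only: ball_Un ball_simps Ball_def[of "{..<_}"] lessThan_iff)
  also have "\<dots> \<longleftrightarrow> (\<forall>i\<in>{1..N}. (\<forall>j<i. inner (g (Some i)) (g (Some j)) = 0) \<and>
                  (\<forall>j\<in>{1..i}. inner (g (Some i)) (x (Some j) - x (Some 0)) = 0))"
  proof (intro ball_cong refl)
    fix i assume i: "i \<in> {1..N}"
    then have "\<forall>j<i. H i j = inner (g (Some i)) (g (Some j))"
      "\<forall>l\<in>{1..i}. H i (N + l) = inner (g (Some i)) (x (Some l) - x (Some 0))"
      by (auto simp: H_def P_col_def)
    then show "((\<forall>j<i. H i j = 0) \<and> (\<forall>l\<in>{1..i}. H i (N + l) = 0)) \<longleftrightarrow>
       ((\<forall>j<i. inner (g (Some i)) (g (Some j)) = 0) \<and>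
                  (\<forall>j\<in>{1..i}. inner (g (Some i)) (x (Some j) - x (Some 0)) = 0))" by simp
  qed
  finally have 3: "(\<forall>(i, q)\<in>Sigma {1..N} (\<lambda>i. {..<i} \<union> (+) N ` {1..i}). H i q = 0) \<longleftrightarrow>
      (\<forall>i\<in>{1..N}. (\<forall>j<i. inner (g (Some i)) (g (Some j)) = 0) \<and>
                  (\<forall>j\<in>{1..i}. inner (g (Some i)) (x (Some j) - x (Some 0)) = 0))" .
  have "H (2 * N + 1) (2 * N + 1) = (norm (x (Some 0) - x None))\<^sup>2"
    by (simp add: H_def P_col_def power2_norm_eq_inner inner_commute inner_diff algebra_simps)
  then have 4: "H (2 * N + 1) (2 * N + 1) \<le> R\<^sup>2 \<longleftrightarrow> norm (x (Some 0) - x None) \<le> R"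
    using R by (simp add: abs_le_square_iff[symmetric])
  show ?thesis unfolding relaxed_run_def 1 3 4 using g by blast
qed

text \<open>
  The size \<open>2N + 2\<close> is not the cardinality of a type. The indices below \<open>n\<close> are therefore injected by
  \<open>\<iota>\<close> into an index type that may be larger.
\<close>

definition extend_by_zero :: "(nat \<Rightarrow> 'n) \<Rightarrow> nat \<Rightarrow> (nat \<Rightarrow> 'a::zero) \<Rightarrow> 'n \<Rightarrow> 'a" where
  "extend_by_zero \<iota> n c r = (if r \<in> \<iota> ` {..<n} then c (inv_into {..<n} \<iota> r) else 0)"

lemma extend_by_zero_apply [simp]:
  "inj_on \<iota> {..<n} \<Longrightarrow> p < n \<Longrightarrow> extend_by_zero \<iota> n c (\<iota> p) = c p"
  by (simp add: extend_by_zero_def inv_into_f_f)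

lemma extend_by_zero_outside: "r \<notin> \<iota> ` {..<n} \<Longrightarrow> extend_by_zero \<iota> n c r = 0"
  by (simp add: extend_by_zero_def)

text \<open>
  Conic duality on the Gram cone gives multipliers \<open>\<alpha>'\<close> for the affine constraints, where each
  orthogonality equation counts as two inequalities. Besides their signs only the inequality
  \<open>certificate\<close>, valid on the whole cone, is used. At zero it is the bound on the dual objective. At
  large multiples of \<open>v v\<^sup>T\<close> it forces the dual matrix to be positive semidefinite, and at arbitrary
  function values it forces the equality constraint of \<open>(D)\<close>.
\<close>

lemma relaxed_run_strong_duality:
  fixes \<F> :: "(real ^ 'd \<Rightarrow> ereal) set" and K :: "'k set" and X G :: "'t \<Rightarrow> nat option \<Rightarrow> real ^ 'd"
  assumes enc: "encodes_interpolation N \<F> K A a b" and R: "R \<ge> 0" and card: "CARD('d) \<ge> 2 * N + 2"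
    and T: "finite T" "T \<noteq> {}" "\<And>t. t \<in> T \<Longrightarrow> relaxed_run \<F> R N (X t) (G t) (V t)"
    and nondeg: "\<And>u p. \<forall>t\<in>T. (\<Sum>p<2 * N + 2. u p *\<^sub>R P_col N (X t) (G t) p) = 0 \<Longrightarrow> p < 2 * N + 2 \<Longrightarrow> u p = 0"
    and bound: "\<And>x g fv. relaxed_run \<F> R N x g fv \<Longrightarrow> fv (Some N) - fv None \<le> B"
  shows "\<exists>\<alpha> \<beta> \<gamma> \<tau>. dual_feasible N K A a \<alpha> \<beta> \<gamma> \<tau> \<and> \<tau> * R\<^sup>2 - (\<Sum>k\<in>K. \<alpha> k * b k) \<le> B"
proof -
  let ?n = "2 * N + 2"
  have K: "finite K" and A: "\<And>k. k \<in> K \<Longrightarrow> A k \<in> carrier_mat ?n ?n"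
    and a: "\<And>k. k \<in> K \<Longrightarrow> a k \<in> carrier_vec (N + 2)"
    using enc by (auto simp: encodes_interpolation_def)
  obtain \<iota>' :: "nat \<Rightarrow> 'd" where "bij_betw \<iota>' {0..<CARD('d)} UNIV"
    using ex_bij_betw_nat_finite[of "UNIV :: 'd set"] by auto
  then have "inj_on \<iota>' {..<?n}"
    using card by (auto simp: bij_betw_def intro: inj_on_subset)
  then obtain \<iota> :: "nat \<Rightarrow> 'd" where \<iota>: "inj_on \<iota> {..<?n}" by blast
  define S where "S = \<iota> ` {..<?n}"
  define C where "C = (gram_cone S :: ((real ^ 'd ^ 'd) \<times> (real ^ 'd)) set)"
  define H where "H y p q = vec_nth (vec_nth (fst y) (\<iota> p)) (\<iota> q)" for y :: "(real ^ 'd ^ 'd) \<times> (real ^ 'd)" and p q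
  define v where "v y p = vec_nth (snd y) (\<iota> p)" for y :: "(real ^ 'd ^ 'd) \<times> (real ^ 'd)" and p
  define J where "J = Sigma {1..N} (\<lambda>i. {..<i} \<union> (+) N ` {1..i})"
  define I where "I = Inl ` (insert None (Some ` K)) \<union> Inr ` (J \<times> (UNIV :: bool set))"
  define \<phi> where "\<phi> i y = (case i of
       Inl None \<Rightarrow> H y (2 * N + 1) (2 * N + 1)
     | Inl (Some k) \<Rightarrow> mat_form (A k) (H y) + (\<Sum>p<N + 2. vec_index (a k) p * v y p)
     | Inr ((i, q), s) \<Rightarrow> (if s then 1 else -1) * H y i q)" for i y
  define \<theta> where "\<theta> i = (case i of Inl None \<Rightarrow> - R\<^sup>2 | Inl (Some k) \<Rightarrow> b k | Inr _ \<Rightarrow> 0)"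
    for i :: "'k option + (nat \<times> nat) \<times> bool"
  define c where "c y = v y N - v y (N + 1)" for y
  have H_lin: "H (y + z) p q = H y p q + H z p q" "H (s *\<^sub>R y) p q = s * H y p q" for y z s p q
    by (simp_all add: H_def)
  have v_lin: "v (y + z) p = v y p + v z p" "v (s *\<^sub>R y) p = s * v y p" for y z s p
    by (simp_all add: v_def)
  have finI: "finite I" using K by (simp add: I_def J_def)
  have linc: "linear c" by (intro linearI) (simp_all add: c_def v_lin algebra_simps)
  have form_lin: "mat_form L (H (y + z)) = mat_form L (H y) + mat_form L (H z)"
    "mat_form L (H (s *\<^sub>R y)) = s * mat_form L (H y)" for L y z s
    by (simp_all add: mat_form_def H_lin distrib_left sum.distrib sum_distrib_left mult.left_commute)
  have pair_lin: "(\<Sum>p<n. d p * v (y + z) p) = (\<Sum>p<n. d p * v y p) + (\<Sum>p<n. d p * v z p)"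
    "(\<Sum>p<n. d p * v (s *\<^sub>R y) p) = s * (\<Sum>p<n. d p * v y p)" for d n y z s
    by (simp_all add: v_lin distrib_left sum.distrib sum_distrib_left mult.left_commute)
  have lin\<phi>: "linear (\<phi> i)" for i
    by (intro linearI)
      (simp_all add: \<phi>_def form_lin pair_lin H_lin distrib_left add_ac split: sum.splits option.splits)
  have feasible_iff: "(\<forall>i\<in>I. \<phi> i y + \<theta> i \<le> 0) \<longleftrightarrow>
      (\<forall>k\<in>K. mat_form (A k) (H y) + (\<Sum>p<N + 2. vec_index (a k) p * v y p) + b k \<le> 0) \<and>
      (\<forall>(i, q)\<in>J. H y i q = 0) \<and> H y (2 * N + 1) (2 * N + 1) \<le> R\<^sup>2" for y
  proof -
    have "(\<forall>i\<in>I. \<phi> i y + \<theta> i \<le> 0) \<longleftrightarrow> \<phi> (Inl None) y + \<theta> (Inl None) \<le> 0 \<and>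
        (\<forall>k\<in>K. \<phi> (Inl (Some k)) y + \<theta> (Inl (Some k)) \<le> 0) \<and>
        (\<forall>(i, q)\<in>J. \<phi> (Inr ((i, q), True)) y + \<theta> (Inr ((i, q), True)) \<le> 0 \<and>
                   \<phi> (Inr ((i, q), False)) y + \<theta> (Inr ((i, q), False)) \<le> 0)"
      unfolding I_def UNIV_bool by (auto simp: ball_Un)
    moreover have "(\<forall>(i, q)\<in>J. \<phi> (Inr ((i, q), True)) y + \<theta> (Inr ((i, q), True)) \<le> 0 \<and>
                   \<phi> (Inr ((i, q), False)) y + \<theta> (Inr ((i, q), False)) \<le> 0) \<longleftrightarrow> (\<forall>(i, q)\<in>J. H y i q = 0)"
      by (intro ball_cong refl) (auto simp: \<phi>_def \<theta>_def)
    ultimately show ?thesis by (simp add: \<phi>_def \<theta>_def) blast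
  qed
  have feasible_run: "(\<forall>i\<in>I. \<phi> i y + \<theta> i \<le> 0) \<longleftrightarrow> relaxed_run \<F> R N x g fv"
    if "g None = 0" "\<And>p q. p < ?n \<Longrightarrow> q < ?n \<Longrightarrow> H y p q = inner (P_col N x g p) (P_col N x g q)"
      "\<And>p. p < N + 2 \<Longrightarrow> v y p = (if p \<le> N then fv (Some p) else fv None)" for y x g fv
  proof -
    have "mat_form (A k) (H y) = mat_form (A k) (\<lambda>p q. inner (P_col N x g p) (P_col N x g q))" if "k \<in> K" for k
      unfolding mat_form_carrier[OF A[OF that]] using \<open>\<And>p q. p < ?n \<Longrightarrow> q < ?n \<Longrightarrow> _ p q\<close>
      by (intro sum.cong refl) auto
    moreover have "(\<Sum>p<N + 2. vec_index (a k) p * v y p)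
        = (\<Sum>p<N + 2. vec_index (a k) p * (if p \<le> N then fv (Some p) else fv None))" for k
      using that(3) by (intro sum.cong refl) auto
    moreover have "H y i q = inner (P_col N x g i) (P_col N x g q)" if "(i, q) \<in> J" for i q
      using that \<open>\<And>p q. p < ?n \<Longrightarrow> q < ?n \<Longrightarrow> _ p q\<close> by (auto simp: J_def)
    ultimately show ?thesis
      unfolding feasible_iff relaxed_run_iff[where g = g, OF enc R that(1)] J_def[symmetric]
      using that(2)[of "2 * N + 1" "2 * N + 1"] by (auto cong: ball_cong)
  qed

  have upper: "c y \<le> B" if "y \<in> C" "\<forall>i\<in>I. \<phi> i y + \<theta> i \<le> 0" for y
  proof -
    obtain P :: "'d \<Rightarrow> real ^ 'd" and F where y: "y = (gram P, F)" using \<open>y \<in> C\<close> by (auto simp: C_def gram_cone_def)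
    define x where "x i = (case i of None \<Rightarrow> P (\<iota> (2 * N + 1)) | Some j \<Rightarrow> if j = 0 then 0 else P (\<iota> (N + j)))" for i
    define g where "g i = (case i of None \<Rightarrow> 0 | Some j \<Rightarrow> P (\<iota> j))" for i
    define fv where "fv i = (case i of None \<Rightarrow> v y (N + 1) | Some j \<Rightarrow> v y j)" for i
    have col: "P_col N x g p = P (\<iota> p)" if "p < ?n" for p
    proof -
      have "p = 2 * N + 1" if "\<not> p \<le> 2 * N" using that \<open>p < ?n\<close> by simp
      then show ?thesis by (auto simp: P_col_def x_def g_def)
    qed
    have "relaxed_run \<F> R N x g fv"
    proof (rule feasible_run[THEN iffD1, OF _ _ _ that(2)])
      show "g None = 0" by (simp add: g_def)
      show "H y p q = inner (P_col N x g p) (P_col N x g q)" if "p < ?n" "q < ?n" for p q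
        using that by (simp add: col H_def y gram_def)
      show "v y p = (if p \<le> N then fv (Some p) else fv None)" if "p < N + 2" for p
      proof -
        have "p = N + 1" if "\<not> p \<le> N" using that \<open>p < N + 2\<close> by simp
        then show ?thesis by (auto simp: fv_def)
      qed
    qed
    from bound[OF this] show ?thesis by (simp add: c_def fv_def)
  qed

  \<comment> \<open>the Slater point \<open>z\<close> is the average of the given relaxed runs\<close>
  define Q where "Q t = extend_by_zero \<iota> ?n (P_col N (X t) (G t))" for t
  define F where "F t = (vec_lambda (extend_by_zero \<iota> ?n (\<lambda>p. if p \<le> N then V t (Some p) else V t None)) :: real ^ 'd)" for t
  define w where "w t = 1 / real (card T)" for t :: 't
  define z where "z = (\<Sum>t\<in>T. w t *\<^sub>R (gram (Q t), F t))"
  have w: "w t > 0" "(\<Sum>t\<in>T. w t) = 1" for t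
    using T(1,2) by (simp_all add: w_def card_gt_0_iff)
  have Q_out: "Q t r = 0" if "r \<notin> S" for t r
    using that unfolding Q_def S_def by (rule extend_by_zero_outside)
  have QC: "(gram (Q t), F t) \<in> C" for t
    unfolding C_def by (intro gram_coneI Q_out)
  have C_add: "x + y \<in> C" if "x \<in> C" "y \<in> C" for x y
    using that unfolding C_def by (rule gram_cone_add)
  have C_scale: "s *\<^sub>R x \<in> C" if "x \<in> C" "s \<ge> 0" for s x
    using that unfolding C_def by (rule gram_cone_scale)
  have zC: "z \<in> C"
  proof -
    have "(\<Sum>t\<in>T'. w t *\<^sub>R (gram (Q t), F t)) \<in> C" if "finite T'" for T'
      using that
    proof induction
      case empty
      show ?case using C_scale[OF QC, of 0] by (simp add: zero_prod_def)
    next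
      case (insert t T')
      then show ?case using C_add C_scale[OF QC] w(1) by (simp add: less_imp_le)
    qed
    then show ?thesis using T(1) by (simp add: z_def)
  qed
  have z_feasible: "\<forall>i\<in>I. \<phi> i z + \<theta> i \<le> 0"
  proof
    fix i assume i: "i \<in> I"
    have "\<phi> i (gram (Q t), F t) + \<theta> i \<le> 0" if t: "t \<in> T" for t
    proof -
      have "\<forall>i\<in>I. \<phi> i (gram (Q t), F t) + \<theta> i \<le> 0"
      proof (rule feasible_run[THEN iffD2, OF _ _ _ T(3)[OF t]])
        show "G t None = 0" using T(3)[OF t] by (simp add: relaxed_run_def)
        show "H (gram (Q t), F t) p q = inner (P_col N (X t) (G t) p) (P_col N (X t) (G t) q)"
          if "p < ?n" "q < ?n" for p q
          using that \<iota> by (simp add: H_def gram_def Q_def)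
        show "v (gram (Q t), F t) p = (if p \<le> N then V t (Some p) else V t None)" if "p < N + 2" for p
          using that \<iota> by (simp add: v_def F_def)
      qed
      then show ?thesis using i by blast
    qed
    then have "(\<Sum>t\<in>T. w t * (\<phi> i (gram (Q t), F t) + \<theta> i)) \<le> 0"
      using w(1) by (intro sum_nonpos mult_nonneg_nonpos) (auto simp: less_imp_le)
    moreover have "\<phi> i z = (\<Sum>t\<in>T. w t * \<phi> i (gram (Q t), F t))"
      unfolding z_def linear_sum[OF lin\<phi>] linear_scale[OF lin\<phi>] by simp
    ultimately show "\<phi> i z + \<theta> i \<le> 0"
      using w(2) by (simp add: distrib_left sum.distrib flip: sum_distrib_right)
  qed
  have slater: "inner m x = 0" if "\<forall>y\<in>C. inner m y \<ge> 0" "inner m z \<le> 0" "x \<in> C" for m x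
  proof (rule gram_cone_dual_vanishes[where T = T and c = w and S = S and Q = Q and F = F])
    show "u = 0" if u: "\<forall>r. r \<notin> S \<longrightarrow> vec_nth u r = 0" "\<forall>t\<in>T. (\<Sum>r\<in>UNIV. vec_nth u r *\<^sub>R Q t r) = 0" for u
    proof -
      have "(\<Sum>p<?n. vec_nth u (\<iota> p) *\<^sub>R P_col N (X t) (G t) p) = (\<Sum>r\<in>UNIV. vec_nth u r *\<^sub>R Q t r)" for t
      proof -
        have "(\<Sum>r\<in>UNIV. vec_nth u r *\<^sub>R Q t r) = (\<Sum>r\<in>S. vec_nth u r *\<^sub>R Q t r)"
          using Q_out by (intro sum.mono_neutral_right) auto
        also have "\<dots> = (\<Sum>p<?n. vec_nth u (\<iota> p) *\<^sub>R Q t (\<iota> p))"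
          unfolding S_def by (simp only: sum.reindex[OF \<iota>] o_def)
        finally show ?thesis using \<iota> by (simp add: Q_def)
      qed
      then have "\<forall>t\<in>T. (\<Sum>p<?n. vec_nth u (\<iota> p) *\<^sub>R P_col N (X t) (G t) p) = 0" using u(2) by simp
      then have "vec_nth u (\<iota> p) = 0" if "p < ?n" for p
        using nondeg[of "\<lambda>p. vec_nth u (\<iota> p)"] that by blast
      then have "vec_nth u r = 0" for r using u(1) by (cases "r \<in> S") (auto simp: S_def)
      then show ?thesis by (simp add: Finite_Cartesian_Product.vec_eq_iff)
    qed
  qed (use that T(1) w(1) Q_out in \<open>simp_all add: C_def z_def\<close>)
  have "\<exists>\<alpha>. (\<forall>i\<in>I. \<alpha> i \<ge> 0) \<and> (\<forall>y\<in>C. c y - B \<le> (\<Sum>i\<in>I. \<alpha> i * (\<phi> i y + \<theta> i)))"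
    by (rule conic_strong_duality[OF C_add C_scale finI linc lin\<phi> zC z_feasible slater upper])
  then obtain \<alpha>' where \<alpha>': "\<forall>i\<in>I. \<alpha>' i \<ge> 0" "\<forall>y\<in>C. c y - B \<le> (\<Sum>i\<in>I. \<alpha>' i * (\<phi> i y + \<theta> i))"
    by blast
  define \<alpha> where "\<alpha> k = \<alpha>' (Inl (Some k))" for k
  define \<tau> where "\<tau> = \<alpha>' (Inl None)"
  define \<mu> where "\<mu> i q = \<alpha>' (Inr ((i, q), True)) - \<alpha>' (Inr ((i, q), False))" for i q
  define M where "M = dual_matrix N K A \<alpha> \<mu> (\<lambda>i j. \<mu> i (N + j)) \<tau>"
  define e where "e p = (if p = N then 1 else if p = N + 1 then -1 else (0::real))" for p
  define \<kappa> where "\<kappa> = B - (\<tau> * R\<^sup>2 - (\<Sum>k\<in>K. \<alpha> k * b k))"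
  have M_carrier: "M \<in> carrier_mat ?n ?n" unfolding M_def by (rule dual_matrix_carrier)
  have certificate: "0 \<le> mat_form M (H y) + (\<Sum>p<N + 2. ((\<Sum>k\<in>K. \<alpha> k * vec_index (a k) p) - e p) * v y p) + \<kappa>"
    if "y \<in> C" for y
  proof -
    have sym: "H y p q = H y q p" for p q
      using that by (auto simp: C_def gram_cone_def H_def gram_def inner_commute)
    have "(\<Sum>i\<in>I. \<alpha>' i * (\<phi> i y + \<theta> i)) =
        (\<Sum>i\<in>Inl ` insert None (Some ` K). \<alpha>' i * (\<phi> i y + \<theta> i))
        + (\<Sum>i\<in>Inr ` (J \<times> UNIV). \<alpha>' i * (\<phi> i y + \<theta> i))"
      unfolding I_def using K by (intro sum.union_disjoint) (auto simp: J_def)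
    also have "(\<Sum>i\<in>Inl ` insert None (Some ` K). \<alpha>' i * (\<phi> i y + \<theta> i))
        = (\<Sum>i\<in>insert None (Some ` K). \<alpha>' (Inl i) * (\<phi> (Inl i) y + \<theta> (Inl i)))"
      by (subst sum.reindex) (auto simp: o_def simp del: image_insert)
    also have "(\<Sum>i\<in>Inr ` (J \<times> UNIV). \<alpha>' i * (\<phi> i y + \<theta> i))
        = (\<Sum>j\<in>J \<times> UNIV. \<alpha>' (Inr j) * (\<phi> (Inr j) y + \<theta> (Inr j)))"
      by (simp add: sum.reindex)
    also have "(\<Sum>j\<in>J \<times> UNIV. \<alpha>' (Inr j) * (\<phi> (Inr j) y + \<theta> (Inr j)))
        = (\<Sum>j\<in>J. \<Sum>s\<in>UNIV. \<alpha>' (Inr (j, s)) * (\<phi> (Inr (j, s)) y + \<theta> (Inr (j, s))))"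
      by (simp add: sum.cartesian_product split_def)
    also have "\<dots> = (\<Sum>(i, q)\<in>J. \<mu> i q * H y i q)"
      by (intro sum.cong refl) (auto simp: UNIV_bool \<phi>_def \<theta>_def \<mu>_def algebra_simps)
    also have "(\<Sum>i\<in>insert None (Some ` K). \<alpha>' (Inl i) * (\<phi> (Inl i) y + \<theta> (Inl i)))
        = \<tau> * (H y (2 * N + 1) (2 * N + 1) - R\<^sup>2)
        + (\<Sum>k\<in>K. \<alpha> k * (mat_form (A k) (H y) + (\<Sum>p<N + 2. vec_index (a k) p * v y p) + b k))"
      using K by (simp add: sum.reindex \<phi>_def \<theta>_def \<tau>_def \<alpha>_def)
    finally have 1: "(\<Sum>i\<in>I. \<alpha>' i * (\<phi> i y + \<theta> i)) =
        \<tau> * (H y (2 * N + 1) (2 * N + 1) - R\<^sup>2)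
        + (\<Sum>k\<in>K. \<alpha> k * (mat_form (A k) (H y) + (\<Sum>p<N + 2. vec_index (a k) p * v y p) + b k))
        + (\<Sum>(i, q)\<in>J. \<mu> i q * H y i q)" .
    have 2: "mat_form M (H y) = (\<Sum>k\<in>K. \<alpha> k * mat_form (A k) (H y))
        + (\<Sum>(i, q)\<in>J. \<mu> i q * H y i q) + \<tau> * H y (2 * N + 1) (2 * N + 1)"
      unfolding M_def J_def sum_equality_multipliers by (rule mat_form_dual_matrix[OF A sym])
    have "(\<Sum>k\<in>K. \<alpha> k * (\<Sum>p<N + 2. vec_index (a k) p * v y p))
        = (\<Sum>k\<in>K. \<Sum>p<N + 2. \<alpha> k * vec_index (a k) p * v y p)"
      by (simp only: sum_distrib_left mult.assoc)
    also have "\<dots> = (\<Sum>p<N + 2. \<Sum>k\<in>K. \<alpha> k * vec_index (a k) p * v y p)"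
      by (rule sum.swap)
    also have "\<dots> = (\<Sum>p<N + 2. (\<Sum>k\<in>K. \<alpha> k * vec_index (a k) p) * v y p)"
      by (simp only: sum_distrib_right)
    finally have 3: "(\<Sum>k\<in>K. \<alpha> k * (\<Sum>p<N + 2. vec_index (a k) p * v y p))
        = (\<Sum>p<N + 2. (\<Sum>k\<in>K. \<alpha> k * vec_index (a k) p) * v y p)" .
    have 4: "(\<Sum>p<N + 2. e p * v y p) = c y" by (simp add: e_def c_def)
    have 5: "(\<Sum>k\<in>K. \<alpha> k * (mat_form (A k) (H y) + (\<Sum>p<N + 2. vec_index (a k) p * v y p) + b k))
        = (\<Sum>k\<in>K. \<alpha> k * mat_form (A k) (H y))
        + (\<Sum>p<N + 2. (\<Sum>k\<in>K. \<alpha> k * vec_index (a k) p) * v y p) + (\<Sum>k\<in>K. \<alpha> k * b k)"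
      unfolding 3[symmetric] by (simp only: distrib_left sum.distrib)
    have 6: "(\<Sum>p<N + 2. ((\<Sum>k\<in>K. \<alpha> k * vec_index (a k) p) - e p) * v y p)
        = (\<Sum>p<N + 2. (\<Sum>k\<in>K. \<alpha> k * vec_index (a k) p) * v y p) - c y"
      unfolding 4[symmetric] by (simp only: left_diff_distrib sum_subtractf)
    have "c y - B \<le> (\<Sum>i\<in>I. \<alpha>' i * (\<phi> i y + \<theta> i))" using \<alpha>'(2) that by blast
    then show ?thesis
      unfolding 1 2 5 6 \<kappa>_def right_diff_distrib by linarith
  qed
  have point: "0 \<le> mat_form M (\<lambda>p q. inner (P p) (P q))
      + (\<Sum>p<N + 2. ((\<Sum>k\<in>K. \<alpha> k * vec_index (a k) p) - e p) * F p) + \<kappa>" for P :: "nat \<Rightarrow> real ^ 'd" and F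
  proof -
    define y where "y = (gram (extend_by_zero \<iota> ?n P), vec_lambda (extend_by_zero \<iota> ?n F))"
    have "y \<in> C" unfolding y_def C_def S_def by (intro gram_coneI extend_by_zero_outside)
    moreover have "H y p q = inner (P p) (P q)" if "p < ?n" "q < ?n" for p q
      using that \<iota> by (simp add: y_def H_def gram_def)
    then have "mat_form M (H y) = mat_form M (\<lambda>p q. inner (P p) (P q))"
      unfolding mat_form_carrier[OF M_carrier] by (intro sum.cong refl) auto
    moreover have "v y p = F p" if "p < N + 2" for p
      using that \<iota> by (simp add: y_def v_def)
    ultimately show ?thesis using certificate[of y] by simp
  qed
  have "\<kappa> \<ge> 0" using point[of "\<lambda>_. 0" "\<lambda>_. 0"] by (simp add: mat_form_def)
  moreover have "psd M"
    unfolding psd_iff_mat_form[OF M_carrier]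
  proof
    fix w :: "nat \<Rightarrow> real"
    obtain d :: "real ^ 'd" where d: "d \<in> Basis" using nonempty_Basis by blast
    have "mat_form M (\<lambda>p q. inner ((t * w p) *\<^sub>R d) ((t * w q) *\<^sub>R d)) = t\<^sup>2 * mat_form M (\<lambda>p q. w p * w q)" for t
      using d unfolding mat_form_def sum_distrib_left
      by (intro sum.cong refl) (simp add: inner_Basis power2_eq_square)
    then have "0 \<le> t\<^sup>2 * mat_form M (\<lambda>p q. w p * w q) + \<kappa>" for t
      using point[of "\<lambda>p. (t * w p) *\<^sub>R d" "\<lambda>_. 0"] by simp
    then show "0 \<le> mat_form M (\<lambda>p q. w p * w q)" by (rule quadratic_nonneg_imp_nonneg)
  qed
  moreover have "(\<Sum>k\<in>K. \<alpha> k * vec_index (a k) p) = e p" if p: "p < N + 2" for p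
  proof -
    have "0 \<le> t * ((\<Sum>k\<in>K. \<alpha> k * vec_index (a k) p) - e p) + \<kappa>" for t
    proof -
      have "(\<Sum>q<N + 2. ((\<Sum>k\<in>K. \<alpha> k * vec_index (a k) q) - e q) * (if q = p then t else 0))
          = (\<Sum>q<N + 2. if q = p then t * ((\<Sum>k\<in>K. \<alpha> k * vec_index (a k) p) - e p) else 0)"
        by (intro sum.cong refl) simp
      also have "\<dots> = t * ((\<Sum>k\<in>K. \<alpha> k * vec_index (a k) p) - e p)" using p by simp
      finally show ?thesis
        using point[of "\<lambda>_. 0" "\<lambda>q. if q = p then t else 0"] by (simp add: mat_form_def)
    qed
    from affine_nonneg_imp_zero[OF this] show ?thesis by simp
  qed
  moreover have "\<forall>k\<in>K. \<alpha> k \<ge> 0" "\<tau> \<ge> 0" using \<alpha>'(1) by (auto simp: I_def \<alpha>_def \<tau>_def)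
  ultimately have "dual_feasible N K A a \<alpha> \<mu> (\<lambda>i j. \<mu> i (N + j)) \<tau>"
    unfolding dual_feasible_def M_def e_def
    by (intro conjI iffD2[OF dual_equation_iff[OF a K]] allI impI) simp_all
  then show ?thesis using \<open>\<kappa> \<ge> 0\<close> unfolding \<kappa>_def by force
qed

section \<open>A Slater point and tightness\<close>

text \<open>
  Test the relation with \<open>h = g\<^sub>N\<^sub>+\<^sub>1\<close>. It is orthogonal to \<open>g\<^sub>0, \<dots>, g\<^sub>N\<close> and to all displacements of
  the run, but \<open>\<langle>h, x\<^sub>* - x\<^sub>0\<rangle> < 0\<close> because \<open>x\<^sub>N\<^sub>+\<^sub>1\<close> is not optimal. So the run truncated at
  \<open>k\<close> shows that the coefficients of the columns equal to \<open>x\<^sub>* - x\<^sub>0\<close>, those of \<open>x\<^sub>k, \<dots>, x\<^sub>N, x\<^sub>*\<close>,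
  sum to \<open>0\<close>. Differences over consecutive \<open>k\<close> make each of them \<open>0\<close>. What remains
  is a relation between the subgradients, which are orthogonal and, again by non-optimality, nonzero.
  The displacements of the run alone would not do: consecutive points of a run may coincide.
\<close>

lemma truncated_runs_nondegenerate:
  fixes x g :: "nat \<Rightarrow> 'a::euclidean_space" and u :: "nat \<Rightarrow> real"
  assumes run: "gfom_run (N + 1) f x0 x g" and f: "proper_fun f"
    and xs: "xs \<in> argmin_on f UNIV" and not_opt: "x (N + 1) \<notin> argmin_on f UNIV"
    and dep: "\<And>k. k \<in> {1..N + 1} \<Longrightarrow>
        (\<Sum>p<2 * N + 2. u p *\<^sub>R P_col N (truncate_at k x xs) (truncate_at k g 0) p) = 0"
    and p: "p < 2 * N + 2"
  shows "u p = 0"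
proof -
  define h where "h = g (N + 1)"
  define \<delta> where "\<delta> = inner h (xs - x0)"
  have x0: "x 0 = x0" using run by (simp add: gfom_run_def)
  have fin: "\<bar>f (x i)\<bar> \<noteq> \<infinity>" if "i \<le> N + 1" for i
    using subdifferential_imp_finite[OF f, of "g i" "x i"] run that by (auto simp: gfom_run_def)
  have fxs: "f xs \<le> f y" for y using xs by (auto simp: argmin_on_iff)
  have h_step: "inner h (x j - x0) = 0" if "j \<le> N + 1" for j
    using gfom_run_orthogonal[OF run that] by (simp add: h_def)
  have h_grad: "inner h (g j) = 0" if "j \<le> N" for j
    using run that by (auto simp: gfom_run_def h_def)
  have "\<delta> < 0"
  proof (rule ccontr)
    assume "\<not> \<delta> < 0"
    moreover have "inner h (xs - x (N + 1)) = \<delta>"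
      using h_step[of "N + 1"] by (simp add: \<delta>_def inner_diff_right)
    moreover have "f (x (N + 1)) + ereal (inner h (xs - x (N + 1))) \<le> f xs"
      using run by (auto simp: gfom_run_def subdifferential_def h_def)
    ultimately have "f (x (N + 1)) \<le> f xs"
      using fin[of "N + 1"] by (cases "f (x (N + 1))"; cases "f xs") auto
    then have "x (N + 1) \<in> argmin_on f UNIV"
      using fxs order_trans by (fastforce simp: argmin_on_iff)
    with not_opt show False by simp
  qed
  have split_sum: "(\<Sum>p<2 * N + 2. F p) = (\<Sum>p\<le>N. F p) + (\<Sum>j=1..N. F (N + j)) + F (2 * N + 1)"
    for F :: "nat \<Rightarrow> 'a"
  proof -
    have "{..<2 * N + 2} = {..N} \<union> (+) N ` {1..N} \<union> {2 * N + 1}"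
      by (auto simp: image_iff)
    then have "(\<Sum>p<2 * N + 2. F p) = (\<Sum>p\<in>{..N} \<union> (+) N ` {1..N}. F p) + F (2 * N + 1)"
      by (subst sum.union_disjoint[symmetric] | auto)+
    also have "(\<Sum>p\<in>{..N} \<union> (+) N ` {1..N}. F p) = (\<Sum>p\<le>N. F p) + (\<Sum>p\<in>(+) N ` {1..N}. F p)"
      by (rule sum.union_disjoint) auto
    also have "(\<Sum>p\<in>(+) N ` {1..N}. F p) = (\<Sum>j=1..N. F (N + j))"
      by (simp only: sum.reindex[OF inj_on_add] o_def)
    finally show ?thesis .
  qed
  have expand: "(\<Sum>p\<le>N. u p *\<^sub>R truncate_at k g 0 (Some p))
      + (\<Sum>j=1..N. u (N + j) *\<^sub>R (truncate_at k x xs (Some j) - x0)) + u (2 * N + 1) *\<^sub>R (xs - x0) = 0"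
    if k: "k \<in> {1..N + 1}" for k
  proof -
    have "P_col N (truncate_at k x xs) (truncate_at k g 0) p = truncate_at k g 0 (Some p)" if "p \<le> N" for p
      using that by (simp add: P_col_def)
    moreover have "P_col N (truncate_at k x xs) (truncate_at k g 0) (N + j) = truncate_at k x xs (Some j) - x0"
      if "j \<in> {1..N}" for j
      using that k x0 by (simp add: P_col_def truncate_at_def)
    moreover have "P_col N (truncate_at k x xs) (truncate_at k g 0) (2 * N + 1) = xs - x0"
      using k x0 by (simp add: P_col_def truncate_at_def)
    ultimately show ?thesis using dep[OF k] unfolding split_sum by simp
  qed
  define w where "w k = (\<Sum>j=k..N. u (N + j)) + u (2 * N + 1)" for k
  have w: "w k = 0" if k: "k \<in> {1..N + 1}" for k
  proof -
    have "inner h (\<Sum>p\<le>N. u p *\<^sub>R truncate_at k g 0 (Some p)) = 0"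
      unfolding inner_sum_right by (intro sum.neutral) (auto simp: truncate_at_def h_grad)
    moreover have "inner h (\<Sum>j=1..N. u (N + j) *\<^sub>R (truncate_at k x xs (Some j) - x0)) = \<delta> * (\<Sum>j=k..N. u (N + j))"
    proof -
      have "inner h (\<Sum>j=1..N. u (N + j) *\<^sub>R (truncate_at k x xs (Some j) - x0))
          = (\<Sum>j=1..N. if j < k then 0 else \<delta> * u (N + j))"
        unfolding inner_sum_right using h_step by (intro sum.cong refl) (auto simp: truncate_at_def \<delta>_def)
      also have "\<dots> = (\<Sum>j=k..N. if j < k then 0 else \<delta> * u (N + j))"
        using k by (intro sum.mono_neutral_right) auto
      also have "\<dots> = (\<Sum>j=k..N. \<delta> * u (N + j))" by (intro sum.cong refl) auto
      finally show ?thesis by (simp only: sum_distrib_left)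
    qed
    moreover have "inner h (u (2 * N + 1) *\<^sub>R (xs - x0)) = \<delta> * u (2 * N + 1)" by (simp add: \<delta>_def)
    ultimately have "\<delta> * w k = inner h ((\<Sum>p\<le>N. u p *\<^sub>R truncate_at k g 0 (Some p))
      + (\<Sum>j=1..N. u (N + j) *\<^sub>R (truncate_at k x xs (Some j) - x0)) + u (2 * N + 1) *\<^sub>R (xs - x0))"
      by (simp only: w_def inner_add_right distrib_left)
    also have "\<dots> = 0" unfolding expand[OF k] by simp
    finally show ?thesis using \<open>\<delta> < 0\<close> by simp
  qed
  have u_last: "u (2 * N + 1) = 0" using w[of "N + 1"] by (simp add: w_def)
  have u_step: "u (N + k) = 0" if "k \<in> {1..N}" for k
  proof -
    have "(\<Sum>j=k..N. u (N + j)) = u (N + k) + (\<Sum>j=k + 1..N. u (N + j))"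
      using that by (simp add: sum.atLeast_Suc_atMost)
    then show ?thesis using w[of k] w[of "k + 1"] that by (simp add: w_def)
  qed
  have u_grad: "u j = 0" if "j \<le> N" for j
  proof -
    have "(\<Sum>p\<le>N. u p *\<^sub>R truncate_at (N + 1) g 0 (Some p)) = (\<Sum>p\<le>N. u p *\<^sub>R g p)"
      by (intro sum.cong refl) (simp add: truncate_at_def)
    then have "(\<Sum>p\<le>N. u p *\<^sub>R g p) = 0"
      using expand[of "N + 1"] u_last u_step by simp
    moreover have "inner (g i) (g j) = 0" if "i \<in> {..N}" "i \<noteq> j" for i
      using run that \<open>j \<le> N\<close> inner_commute[of "g i" "g j"]
      by (cases "i < j") (auto simp: gfom_run_def)
    ultimately have "u j * inner (g j) (g j) = 0"
      using inner_orthogonal_sum[of "{..N}" j g u] that by simp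
    moreover have "g j \<noteq> 0"
    proof
      assume "g j = 0"
      moreover have "g j \<in> subdifferential f (x j)" using run that by (simp add: gfom_run_def)
      ultimately have "x j \<in> argmin_on f UNIV" by (simp flip: zero_subdifferential_iff)
      then have "f (x (N + 1)) \<le> f y" for y
        using gfom_run_decreasing[OF run, of j "N + 1"] that order_trans by (fastforce simp: argmin_on_iff)
      with not_opt show False by (simp add: argmin_on_iff)
    qed
    ultimately show ?thesis by simp
  qed
  consider "p \<le> N" | "p - N \<in> {1..N}" "p = N + (p - N)" | "p = 2 * N + 1"
    using p by force
  then show ?thesis using u_grad u_step u_last by cases metis+
qed

theorem theorem3:
  fixes N :: nat
    and R :: real
    and \<F> :: "(real ^ 'd \<Rightarrow> ereal) set"
    and K :: "'k set"
    and A :: "'k \<Rightarrow> real Matrix.mat"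
    and a :: "'k \<Rightarrow> real Matrix.vec"
    and b :: "'k \<Rightarrow> real"
  assumes "N \<ge> 1"
    and "R \<ge> 0"
    and "\<forall>f\<in>\<F>. closed_convex_proper f"
    and "encodes_interpolation N \<F> K A a b"
  shows "(\<forall>f x0 y. is_input \<F> R f x0 \<longrightarrow> gfom_output N f x0 y \<longrightarrow>
            f y - min_value f \<le> dual_value N R K A a b) \<and>
         (contraction_preserving \<F> \<longrightarrow> CARD('d) \<ge> 2 * N + 2 \<longrightarrow>
          (\<exists>f x0 y. is_input \<F> R f x0 \<and> gfom_output (2 * N + 1) f x0 y \<and>
                    y \<notin> argmin_on f UNIV) \<longrightarrow>
          tight_bound N \<F> R (dual_value N R K A a b))"
proof (intro conjI allI impI)
  fix f x0 y
  assume "is_input \<F> R f x0" "gfom_output N f x0 y"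
  then obtain xs x g where f: "f \<in> \<F>" and xs: "xs \<in> argmin_on f UNIV" "norm (x0 - xs) \<le> R"
    and run: "gfom_run N f x0 x g" and y: "y = x N"
    by (auto simp: is_input_def gfom_output_def)
  have proper: "proper_fun f" using assms(3) f by (auto simp: closed_convex_proper_def)
  have "\<bar>f xs\<bar> \<noteq> \<infinity>"
    using subdifferential_imp_finite[OF proper] xs(1) by (simp flip: zero_subdifferential_iff)
  moreover have "\<bar>f y\<bar> \<noteq> \<infinity>"
    using subdifferential_imp_finite[OF proper, of "g N"] run by (auto simp: gfom_run_def y)
  ultimately have val: "f y - min_value f = ereal (real_of_ereal (f y) - real_of_ereal (f xs))"
    using min_value_eq[OF xs(1)] by (cases "f y"; cases "f xs") auto
  have rel: "relaxed_run \<F> R N (truncate_at (N + 1) x xs) (truncate_at (N + 1) g 0)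
      (\<lambda>i. real_of_ereal (f (truncate_at (N + 1) x xs i)))"
    using truncated_run_relaxed[OF run _ _ f proper xs] by simp
  show "f y - min_value f \<le> dual_value N R K A a b"
    unfolding dual_value_def val
    using relaxed_run_weak_duality[OF assms(4) rel] by (intro Inf_greatest) (auto simp: truncate_at_def y)
next
  assume cp: "contraction_preserving \<F>" and card: "2 * N + 2 \<le> CARD('d)"
  assume "\<exists>f x0 y. is_input \<F> R f x0 \<and> gfom_output (2 * N + 1) f x0 y \<and> y \<notin> argmin_on f UNIV"
  then obtain f x0 xs x g where f: "f \<in> \<F>" and xs: "xs \<in> argmin_on f UNIV" "norm (x0 - xs) \<le> R"
    and long: "gfom_run (2 * N + 1) f x0 x g" and not_opt: "x (2 * N + 1) \<notin> argmin_on f UNIV"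
    by (auto simp: is_input_def gfom_output_def)
  have proper: "proper_fun f" using assms(3) f by (auto simp: closed_convex_proper_def)
  have run: "gfom_run (N + 1) f x0 x g" using gfom_run_mono[OF long] assms(1) by simp
  have "f (x (2 * N + 1)) \<le> f (x (N + 1))"
    using gfom_run_decreasing[OF long, of "N + 1" "2 * N + 1"] by simp
  then have not_opt': "x (N + 1) \<notin> argmin_on f UNIV"
    using not_opt order_trans by (fastforce simp: argmin_on_iff)
  define V where "V k i = real_of_ereal (f (truncate_at k x xs i))" for k i
  have rel: "relaxed_run \<F> R N (truncate_at k x xs) (truncate_at k g 0) (V k)" if "k \<in> {1..N + 1}" for k
    unfolding V_def using truncated_run_relaxed[OF run _ _ f proper xs, of k] that by simp
  have dual_le: "dual_value N R K A a b \<le> ereal B"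
    if "\<And>x g fv. relaxed_run \<F> R N x g fv \<Longrightarrow> fv (Some N) - fv None \<le> B" for B
  proof -
    have "\<exists>\<alpha> \<beta> \<gamma> \<tau>. dual_feasible N K A a \<alpha> \<beta> \<gamma> \<tau> \<and> \<tau> * R\<^sup>2 - (\<Sum>k\<in>K. \<alpha> k * b k) \<le> B"
    proof (rule relaxed_run_strong_duality[OF assms(4,2) card])
      show "finite {1..N + 1}" "{1..N + 1} \<noteq> {}" by auto
      show "u p = 0" if "\<forall>k\<in>{1..N + 1}. (\<Sum>p<2 * N + 2. u p *\<^sub>R P_col N (truncate_at k x xs) (truncate_at k g 0) p) = 0"
        "p < 2 * N + 2" for u p
        by (rule truncated_runs_nondegenerate[OF run proper xs(1) not_opt' _ that(2)]) (use that(1) in blast)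
    qed (fact rel that)+
    then obtain \<alpha> \<beta> \<gamma> \<tau> where "dual_feasible N K A a \<alpha> \<beta> \<gamma> \<tau>" "\<tau> * R\<^sup>2 - (\<Sum>k\<in>K. \<alpha> k * b k) \<le> B"
      by blast
    then show ?thesis unfolding dual_value_def by (intro Inf_lower2[of "ereal (\<tau> * R\<^sup>2 - (\<Sum>k\<in>K. \<alpha> k * b k))"]) auto
  qed
  have attained: "\<exists>f x0 y. is_input \<F> R f x0 \<and> gfom_output N f x0 y \<and> ereal B \<le> f y - min_value f"
    if "ereal B' < dual_value N R K A a b" "B \<le> B'" for B B'
  proof -
    have "\<not> (\<forall>x g fv. relaxed_run \<F> R N x g fv \<longrightarrow> fv (Some N) - fv None \<le> B')"
      using dual_le[of B'] that(1) by (auto simp flip: not_le)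
    then obtain x g fv where "relaxed_run \<F> R N x g fv" "B' < fv (Some N) - fv None"
      by (auto simp: not_le)
    with relaxed_run_realizable[OF _ cp assms(1)] that(2) show ?thesis by fastforce
  qed
  show "tight_bound N \<F> R (dual_value N R K A a b)"
    unfolding tight_bound_def
  proof (intro conjI impI allI)
    fix \<epsilon> :: real assume V: "dual_value N R K A a b \<noteq> \<infinity>" and \<epsilon>: "\<epsilon> > 0"
    show "\<exists>f x0 y. is_input \<F> R f x0 \<and> gfom_output N f x0 y \<and>
        dual_value N R K A a b - ereal \<epsilon> \<le> f y - min_value f"
    \<comment> \<open>value \<open>-\<infinity>\<close> is in fact excluded by weak duality, but any run serves in this case\<close>
    proof (cases "dual_value N R K A a b")
      case (real r)
      then show ?thesis using attained[of "r - \<epsilon>" "r - \<epsilon>"] \<epsilon> by simp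
    next
      case MInf
      then show ?thesis using relaxed_run_realizable[OF rel cp assms(1), of 1] by force
    qed (use V in simp)
  next
    fix B :: real assume "dual_value N R K A a b = \<infinity>"
    then show "\<exists>f x0 y. is_input \<F> R f x0 \<and> gfom_output N f x0 y \<and> ereal B \<le> f y - min_value f"
      using attained[of B B] by simp
  qed
qed

end
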